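(* Let $k\ge2$ be an integer, $L>0$, and let $\mathcal{D}$ be a good probability distribution on $[0,1]^{k-1}$. Consider the continuous fragmentation process with $k$ parts started from $R$ living sticks of length $L$, in which each newly created stick is alive with probability $r=1/k$ and dead with probability $1-r$, where the alive/dead statuses of the $k$ children of the same stick are possibly dependent on one another. Let $N=N(R)$ be positive integers with $N(R)\ge\log R$. Then for every base $B>1$ the collection of stick lengths after $N$ levels converges to strong Benford behavior base $B$ as $R\to\infty$: if $P_{R,N}(s)$ is the proportion of the sticks resulting after $N$ levels whose length has base-$B$ significand at most $s$, then for every $s\in[1,B)$, $$\lim_{R\to\infty}\mathbb{E}[P_{R,N(R)}(s)]=\log_B s,\qquad \lim_{R\to\infty}\operatorname{Var}[P_{R,N(R)}(s)]=0 .$$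
   Context: $\log$ is the natural logarithm. Significand: for $B>1$, each $x>0$ is written uniquely as $x=S_B(x)B^{j}$ with $S_B(x)\in[1,B)$, $j\in\mathbb{Z}$; $S_B(x)$ is the significand. Convergence to strong Benford behavior of random finite collections (counted with multiplicity) is by definition the pair of limits displayed in the claim for all $s\in[1,B)$. Good distributions: let $\mathcal{D}$ be a probability distribution on $\mathbb{R}^d$ supported on $[0,1]^d$. For $X\sim\mathcal{D}$ let $\mathrm{rk}_i(X)$ be its $i$-th smallest coordinate ($1\le i\le d$), $\mathrm{rk}_0(X)=0$, $\mathrm{rk}_{d+1}(X)=1$. $\mathcal{D}$ is good if for all $0\le i\le d$ the random variable $\mathrm{rk}_{i+1}(X)-\mathrm{rk}_i(X)$ has a Hölder continuous density (a density being a function on $[0,\infty)$). Process: all $R$ initial sticks are alive. At each level every living stick, of length $\ell$ say, is broken into $k$ pieces (its children) of lengths $\ell(\mathrm{rk}_{i+1}(X)-\mathrm{rk}_i(X))$, $0\le i\le k-1$, where $X\sim\mathcal{D}$ is sampled independently for each living stick. Each child is then declared alive (it will be broken at the next level) or dead (it is never broken again). For each broken stick the vector of statuses of its $k$ children may have an arbitrary joint law with each child alive with probability $r$; the status vectors belonging to different broken sticks are independent of each other, and statuses are independent of the cut points. The sticks resulting after $N$ levels are all sticks present then: those which died at some level $\le N$ together with those still alive after level $N$. *)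

theory Defs
  imports "HOL-Probability.Probability"
begin

definition significand :: "real \<Rightarrow> real \<Rightarrow> real" where
  "significand B x = (THE t. t \<in> {1..<B} \<and> (\<exists>j::int. x = t * B powi j))"

definition hoelder_continuous_on :: "real set \<Rightarrow> (real \<Rightarrow> real) \<Rightarrow> bool" where
  "hoelder_continuous_on S f \<longleftrightarrow>
     (\<exists>\<alpha> C. 0 < \<alpha> \<and> \<alpha> \<le> 1 \<and> (\<forall>x\<in>S. \<forall>y\<in>S. \<bar>f x - f y\<bar> \<le> C * \<bar>x - y\<bar> powr \<alpha>))"

text \<open>A point of \<open>d\<close>-dimensional space is a function on \<open>{..<d}\<close>, and the Borel sets are those of the
  product measurable space \<open>PiM {..<d} (\<lambda>_. borel)\<close>.\<close>

definition rk :: "nat \<Rightarrow> (nat \<Rightarrow> real) \<Rightarrow> nat \<Rightarrow> real" where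
  "rk d x i = (if i = 0 then 0 else if i = d + 1 then 1 else sort (map x [0..<d]) ! (i - 1))"

definition gap :: "nat \<Rightarrow> (nat \<Rightarrow> real) \<Rightarrow> nat \<Rightarrow> real" where
  "gap d x i = rk d x (i + 1) - rk d x i"

text \<open>The density \<open>f\<close> matters on \<open>[0, \<infinity>)\<close> only, and its Hoelder continuity is required there only.\<close>

definition good_distribution :: "nat \<Rightarrow> (nat \<Rightarrow> real) measure \<Rightarrow> bool" where
  "good_distribution d D \<longleftrightarrow>
     prob_space D \<and>
     sets D = sets (PiM {..<d} (\<lambda>_. borel)) \<and>
     (AE x in D. \<forall>i<d. x i \<in> {0..1}) \<and>
     (\<forall>i\<le>d. \<exists>f. (\<forall>t\<ge>0. 0 \<le> f t) \<and> hoelder_continuous_on {0..} f \<and>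
        distributed D lborel (\<lambda>x. gap d x i) (\<lambda>t. ennreal (if 0 \<le> t then f t else 0)))"

text \<open>A potential stick is a pair \<open>(j, p)\<close>: the initial stick \<open>j\<close> it comes from, and the list \<open>p\<close> of
  child indices leading to it, the most recent index first. Its level is \<open>length p\<close>.\<close>

type_synonym stick = "nat \<times> nat list"

definition potential_sticks :: "nat \<Rightarrow> nat \<Rightarrow> stick set" where
  "potential_sticks k R = {..<R} \<times> lists {..<k}"

text \<open>\<open>X v\<close> is the vector of cut points used if \<open>v\<close> is broken, and \<open>A v \<omega> i\<close> says that the \<open>i\<close>-th child of \<open>v\<close> is
  alive. Both are given for every potential stick; those of sticks that are never broken
  do not influence the process. The joint law of the statuses of the children may vary from stick to
  stick. The last assumption is \<open>indep_var\<close> for the two whole families, which have different types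
  and hence are not in the scope of \<open>indep_var\<close> itself.\<close>

locale fragmentation = prob_space M
  for M :: "'a measure"
  and k :: nat and r :: real and D :: "(nat \<Rightarrow> real) measure" and R :: nat
  and X :: "stick \<Rightarrow> 'a \<Rightarrow> nat \<Rightarrow> real"
  and A :: "stick \<Rightarrow> 'a \<Rightarrow> nat \<Rightarrow> bool" +
  assumes cuts_indep: "indep_vars (\<lambda>_. D) X (potential_sticks k R)"
    and cuts_law: "\<And>v. v \<in> potential_sticks k R \<Longrightarrow> distr M D (X v) = D"
    and statuses_indep:
      "indep_vars (\<lambda>_. PiM {..<k} (\<lambda>_. count_space UNIV)) A (potential_sticks k R)"
    and alive_prob:
      "\<And>v i. v \<in> potential_sticks k R \<Longrightarrow> i < k \<Longrightarrow> prob {\<omega> \<in> space M. A v \<omega> i} = r"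
    and cuts_statuses_indep:
      "indep_set
         {(\<lambda>\<omega>. \<lambda>v\<in>potential_sticks k R. X v \<omega>) -` E \<inter> space M | E.
            E \<in> sets (PiM (potential_sticks k R) (\<lambda>_. D))}
         {(\<lambda>\<omega>. \<lambda>v\<in>potential_sticks k R. A v \<omega>) -` F \<inter> space M | F.
            F \<in> sets (PiM (potential_sticks k R) (\<lambda>_. PiM {..<k} (\<lambda>_. count_space UNIV)))}"

fun stick_length ::
  "nat \<Rightarrow> real \<Rightarrow> (stick \<Rightarrow> 'a \<Rightarrow> nat \<Rightarrow> real) \<Rightarrow> 'a \<Rightarrow> stick \<Rightarrow> real" where
  "stick_length k L X \<omega> (j, []) = L"
| "stick_length k L X \<omega> (j, i # p) = stick_length k L X \<omega> (j, p) * gap (k - 1) (X (j, p) \<omega>) i"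

text \<open>\<open>alive A \<omega> v\<close>: the stick \<open>v\<close> is created and declared alive.
  \<open>created A \<omega> v\<close>: \<open>v\<close> is an initial stick, or its parent is alive (and hence is broken).\<close>

fun alive :: "(stick \<Rightarrow> 'a \<Rightarrow> nat \<Rightarrow> bool) \<Rightarrow> 'a \<Rightarrow> stick \<Rightarrow> bool" where
  "alive A \<omega> (j, []) \<longleftrightarrow> True"
| "alive A \<omega> (j, i # p) \<longleftrightarrow> alive A \<omega> (j, p) \<and> A (j, p) \<omega> i"

fun created :: "(stick \<Rightarrow> 'a \<Rightarrow> nat \<Rightarrow> bool) \<Rightarrow> 'a \<Rightarrow> stick \<Rightarrow> bool" where
  "created A \<omega> (j, []) \<longleftrightarrow> True"
| "created A \<omega> (j, i # p) \<longleftrightarrow> alive A \<omega> (j, p)"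

definition resulting_sticks ::
  "nat \<Rightarrow> nat \<Rightarrow> (stick \<Rightarrow> 'a \<Rightarrow> nat \<Rightarrow> bool) \<Rightarrow> nat \<Rightarrow> 'a \<Rightarrow> stick set" where
  "resulting_sticks k R A N \<omega> =
     {v \<in> potential_sticks k R. created A \<omega> v \<and>
        (length (snd v) \<le> N \<and> \<not> alive A \<omega> v \<or> length (snd v) = N \<and> alive A \<omega> v)}"

text \<open>Sticks, not lengths, are counted: this is the proportion with multiplicity.\<close>

definition benford_proportion ::
  "nat \<Rightarrow> real \<Rightarrow> nat \<Rightarrow> (stick \<Rightarrow> 'a \<Rightarrow> nat \<Rightarrow> real) \<Rightarrow> (stick \<Rightarrow> 'a \<Rightarrow> nat \<Rightarrow> bool) \<Rightarrow>
   nat \<Rightarrow> real \<Rightarrow> real \<Rightarrow> 'a \<Rightarrow> real" where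
  "benford_proportion k L R X A N B s \<omega> =
     real (card {v \<in> resulting_sticks k R A N \<omega>. significand B (stick_length k L X \<omega> v) \<le> s}) /
     real (card (resulting_sticks k R A N \<omega>))"

end

theory Submission
  imports Defs
begin

text \<open>
  With \<open>r = 1 / k\<close> every broken stick has one living child on average, so at every level the
  expected number of living sticks is \<open>R\<close>. The proof separates the shape of the process, which is
  determined by the statuses, from the lengths, which are determined by the cut points; the two are
  independent.

  \<^emph>\<open>Lengths.\<close> Write \<open>\<chi>(x) = exp (i t ln x)\<close> with \<open>t \<noteq> 0\<close>. Along a path the length is a product of
  independent gaps. A gap has a density, so \<open>\<chi>\<close> of a gap is not almost surely constant and its mean
  has modulus at most some \<open>\<rho> < 1\<close>, the same for all gaps (\<open>gap_char_uniform_bound\<close>). For two sticks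
  \<open>v\<close> and \<open>w\<close> the mean of \<open>\<chi>(|v|) cnj (\<chi>(|w|))\<close> splits into a product over the broken sticks;
  a broken stick above exactly one of \<open>v\<close> and \<open>w\<close> contributes a factor of modulus at most \<open>\<rho>\<close>. So if
  \<open>v\<close> is at least as deep as \<open>w\<close> and none of its \<open>K\<close> closest ancestors is above \<open>w\<close>, the correlation is
  at most \<open>\<rho> ^ K\<close> (\<open>char_length_pair_bound\<close>). All other \<open>w\<close> of at most the depth of \<open>v\<close> arise from the
  \<open>K\<close>-th ancestor of \<open>v\<close> by at most \<open>K\<close> further breaks, and hence are bounded in number, unless
  the depth of \<open>v\<close> is below \<open>K\<close>; and only \<open>O(R)\<close> sticks are that shallow. Hence for a fixed set \<open>S\<close> of
  sticks the mean square of the average of \<open>\<chi>\<close> over \<open>S\<close> is at most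
  \<open>\<rho> ^ K + 2 c / card S + (c R / card S)\<^sup>2\<close>, where \<open>c\<close> depends only on \<open>k\<close> and \<open>K\<close>
  (\<open>char_sum_second_moment\<close>). This is small as soon as \<open>card S\<close> is a large multiple of \<open>R\<close>, whatever
  the shape of \<open>S\<close>. By Weyl's criterion, in the form \<open>weyl_bound\<close>, the proportion of
  sticks in \<open>S\<close> with significand at most \<open>s\<close> is then close to \<open>log B s\<close> in mean
  (\<open>fixed_sticks_benford\<close>).

  \<^emph>\<open>Shape.\<close> It remains to see that, with probability tending to \<open>1\<close>, the number of resulting sticks is
  at least any given multiple of \<open>R\<close>. It is at least the number of living sticks of level less than
  \<open>N\<close>, and so for any fixed \<open>n \<le> N\<close> at least the number of those of level less than \<open>n\<close>. The latter has mean \<open>n R\<close>,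
  and variance \<open>O(R)\<close> because the \<open>R\<close> families are independent; Chebyshev's inequality applies
  (\<open>few_resulting_sticks_prob\<close>). As \<open>N \<ge> ln R\<close> tends to infinity, \<open>n\<close> may be chosen as large as desired.

  \<^emph>\<open>Conclusion.\<close> By independence the set of resulting sticks may be treated as fixed
  (\<open>expectation_resulting_sticks_le\<close>). So the proportion converges to \<open>log B s\<close> in mean, and since it
  lies in \<open>[0, 1]\<close>, its variance tends to \<open>0\<close> (\<open>moments_near_constant\<close>).
\<close>

section \<open>Weyl's criterion with an explicit error\<close>

inductive trig_poly :: "(real \<Rightarrow> complex) \<Rightarrow> bool" where
  monom: "trig_poly (\<lambda>y. c * cis (2 * pi * of_int m * y))"
| add: "trig_poly f \<Longrightarrow> trig_poly g \<Longrightarrow> trig_poly (\<lambda>y. f y + g y)"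

lemma trig_poly_const: "trig_poly (\<lambda>y. c)"
  using trig_poly.monom[of c 0] by simp

lemma trig_poly_mult_monom:
  assumes "trig_poly f"
  shows "trig_poly (\<lambda>y. c * cis (2 * pi * of_int m * y) * f y)"
  using assms
proof induction
  case (monom d n)
  have "(\<lambda>y. c * cis (2 * pi * of_int m * y) * (d * cis (2 * pi * of_int n * y)))
      = (\<lambda>y. (c * d) * cis (2 * pi * of_int (m + n) * y))"
    by (simp add: cis_mult[symmetric] distrib_left distrib_right mult_ac)
  then show ?case by (metis trig_poly.monom)
next
  case (add f g)
  then show ?case
    using trig_poly.add[OF add.IH] by (simp add: distrib_left)
qed

lemma trig_poly_mult:
  assumes "trig_poly f" "trig_poly g"
  shows "trig_poly (\<lambda>y. f y * g y)"
  using assms(1)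
proof induction
  case (monom c m)
  show ?case by (rule trig_poly_mult_monom[OF assms(2)])
next
  case (add f f')
  then show ?case
    using trig_poly.add[OF add.IH] by (simp add: distrib_right)
qed

lemma trig_poly_cos: "trig_poly (\<lambda>y. of_real (cos (2 * pi * y)))"
proof -
  have "(\<lambda>y. complex_of_real (cos (2 * pi * y))) =
     (\<lambda>y. (1/2) * cis (2 * pi * of_int 1 * y) + (1/2) * cis (2 * pi * of_int (-1) * y))"
    by (auto simp: complex_eq_iff)
  then show ?thesis
    using trig_poly.add[OF trig_poly.monom[of "1/2" 1] trig_poly.monom[of "1/2" "-1"]] by presburger
qed

lemma trig_poly_sin: "trig_poly (\<lambda>y. of_real (sin (2 * pi * y)))"
proof -
  have "(\<lambda>y. complex_of_real (sin (2 * pi * y))) =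
     (\<lambda>y. (-\<i>/2) * cis (2 * pi * of_int 1 * y) + (\<i>/2) * cis (2 * pi * of_int (-1) * y))"
    by (auto simp: complex_eq_iff)
  then show ?thesis
    using trig_poly.add[OF trig_poly.monom[of "-\<i>/2" 1] trig_poly.monom[of "\<i>/2" "-1"]] by presburger
qed

text \<open>A linear form on the plane is a combination of \<open>cos\<close> and \<open>sin\<close> on the circle, and trigonometric
  polynomials are closed under sums and products. This makes the Stone--Weierstrass theorem for
  real polynomial functions applicable.\<close>

lemma trig_poly_real_polynomial_function:
  fixes p :: "complex \<Rightarrow> real"
  assumes "real_polynomial_function p"
  shows "trig_poly (\<lambda>y. of_real (p (cis (2 * pi * y))))"
  using assms
proof (induction rule: real_polynomial_function.induct)
  case (linear f)
  interpret bounded_linear f by fact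
  have eq: "f z = Re z * f 1 + Im z * f \<i>" for z
  proof -
    have "f z = f (Re z *\<^sub>R 1 + Im z *\<^sub>R \<i>)"
      by (rule arg_cong[where f = f]) (simp add: complex_eq_iff)
    then show ?thesis by (simp add: add scale)
  qed
  have "trig_poly (\<lambda>y. of_real (cos (2 * pi * y)) * of_real (f 1) + of_real (sin (2 * pi * y)) * of_real (f \<i>))"
    by (intro trig_poly.add trig_poly_mult trig_poly_cos trig_poly_sin trig_poly_const)
  then show ?case
    by (subst eq) simp
next
  case (const c)
  show ?case by (rule trig_poly_const)
next
  case (add f g)
  then show ?case using trig_poly.add[OF add.IH] by simp
next
  case (mult f g)
  then show ?case using trig_poly_mult[OF mult.IH] by simp
qed

lemma has_integral_cis_period:
  "((\<lambda>y. cis (2 * pi * of_int m * y)) has_integral (if m = 0 then 1 else 0)) {0..1::real}"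
proof (cases "m = 0")
  case True
  then show ?thesis using has_integral_const_real[of "1::complex" 0 1] by simp
next
  case False
  let ?c = "2 * pi * of_int m"
  have "((\<lambda>y. cis (?c * y)) has_integral
      (cis (?c * 1) / (\<i> * of_real ?c) - cis (?c * 0) / (\<i> * of_real ?c))) {0..1::real}"
  proof (rule fundamental_theorem_of_calculus)
    fix y :: real
    have "((\<lambda>y. cis (?c * y) / (\<i> * of_real ?c)) has_vector_derivative
        (cis (?c * y) * (\<i> * of_real ?c)) / (\<i> * of_real ?c)) (at y within {0..1})"
      unfolding cis_conv_exp
      by (rule has_vector_derivative_divide)
         (auto intro!: derivative_eq_intros has_vector_derivative_real_field simp: mult_ac)
    then show "((\<lambda>y. cis (?c * y) / (\<i> * of_real ?c)) has_vector_derivative cis (?c * y))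
        (at y within {0..1})"
      using False by simp
  qed simp
  moreover have "cis (?c * 1) = 1"
    using cis_multiple_2pi[of "of_int m"] by (simp add: mult_ac)
  ultimately show ?thesis using False by simp
qed

text \<open>The constant term of a trigonometric polynomial is its integral over a period. The other
  terms, summed over the points \<open>y v\<close>, are multiples of exponential sums of non-zero frequency. The
  constant \<open>C\<close> and the frequencies \<open>F\<close> depend on the polynomial alone, not on the points.\<close>

lemma trig_poly_sum_bound:
  assumes "trig_poly f"
  shows "\<exists>I C F. (f has_integral I) {0..1} \<and> 0 \<le> C \<and> finite F \<and> 0 \<notin> F \<and>
    (\<forall>S y. finite (S :: 'i set) \<longrightarrow>
       cmod ((\<Sum>v\<in>S. f (y v)) - of_nat (card S) * I)
         \<le> C * (\<Sum>m\<in>F. cmod (\<Sum>v\<in>S. cis (2 * pi * of_int m * y v))))"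
  using assms
proof induction
  case (monom c m)
  have I: "((\<lambda>y. c * cis (2 * pi * of_int m * y)) has_integral (c * (if m = 0 then 1 else 0))) {0..1}"
    by (intro has_integral_mult_right has_integral_cis_period)
  show ?case
  proof (cases "m = 0")
    case True
    with I show ?thesis
      by (intro exI[of _ c] exI[of _ 0] exI[of _ "{}"]) auto
  next
    case False
    with I show ?thesis
      by (intro exI[of _ 0] exI[of _ "cmod c"] exI[of _ "{m}"])
         (auto simp: sum_distrib_left[symmetric] norm_mult)
  qed
next
  case (add f g)
  then obtain I C F I' C' F' where
    f: "(f has_integral I) {0..1}" "0 \<le> C" "finite F" "0 \<notin> F" "\<And>S y. finite (S :: 'i set) \<Longrightarrow>
       cmod ((\<Sum>v\<in>S. f (y v)) - of_nat (card S) * I)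
         \<le> C * (\<Sum>m\<in>F. cmod (\<Sum>v\<in>S. cis (2 * pi * of_int m * y v)))" and
    g: "(g has_integral I') {0..1}" "0 \<le> C'" "finite F'" "0 \<notin> F'" "\<And>S y. finite (S :: 'i set) \<Longrightarrow>
       cmod ((\<Sum>v\<in>S. g (y v)) - of_nat (card S) * I')
         \<le> C' * (\<Sum>m\<in>F'. cmod (\<Sum>v\<in>S. cis (2 * pi * of_int m * y v)))"
    by metis
  show ?case
  proof (intro exI conjI allI impI)
    show "((\<lambda>y. f y + g y) has_integral I + I') {0..1}"
      using f g by (intro has_integral_add)
    show "0 \<le> C + C'" "finite (F \<union> F')" "0 \<notin> F \<union> F'" using f g by auto
    fix S :: "'i set" and y assume S: "finite S"
    let ?W = "\<lambda>F. \<Sum>m\<in>F. cmod (\<Sum>v\<in>S. cis (2 * pi * of_int m * y v))"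
    have "(\<Sum>v\<in>S. f (y v) + g (y v)) - of_nat (card S) * (I + I')
        = ((\<Sum>v\<in>S. f (y v)) - of_nat (card S) * I) + ((\<Sum>v\<in>S. g (y v)) - of_nat (card S) * I')"
      by (simp add: sum.distrib algebra_simps)
    also have "cmod \<dots> \<le> C * ?W F + C' * ?W F'"
      by (rule norm_triangle_le) (intro add_mono f g S)
    also have "\<dots> \<le> C * ?W (F \<union> F') + C' * ?W (F \<union> F')"
      using f g by (intro add_mono mult_left_mono sum_mono2) auto
    finally show "cmod ((\<Sum>v\<in>S. f (y v) + g (y v)) - of_nat (card S) * (I + I'))
        \<le> (C + C') * ?W (F \<union> F')"
      by (simp add: distrib_right)
  qed
qed

text \<open>The end points \<open>0\<close> and \<open>1\<close> are excluded since they are identified on the circle.\<close>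

lemma cis_2pi_in_arc_iff:
  fixes a b y :: real
  assumes "0 \<le> a" "b \<le> 1" "0 < y" "y < 1"
  shows "cis (2 * pi * y) \<in> (\<lambda>t. cis (2 * pi * t)) ` {a..b} \<longleftrightarrow> y \<in> {a..b}"
proof
  assume "cis (2 * pi * y) \<in> (\<lambda>t. cis (2 * pi * t)) ` {a..b}"
  then obtain t where t: "t \<in> {a..b}" "cis (2 * pi * y) = cis (2 * pi * t)" by auto
  then have "cos (2 * pi * y) = cos (2 * pi * t)" "sin (2 * pi * y) = sin (2 * pi * t)"
    by (auto simp: complex_eq_iff)
  then obtain n where n: "2 * pi * y = 2 * pi * t + 2 * pi * of_int n"
    using sin_cos_eq_iff[of "2 * pi * y" "2 * pi * t"] by (auto simp: mult_ac)
  then have "2 * pi * y = 2 * pi * (t + of_int n)" by (simp add: distrib_left)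
  then have "y = t + of_int n" by simp
  moreover have "n = 0"
  proof -
    have "of_int n < (1::real)" "of_int n > (-1::real)"
      using assms t \<open>y = t + of_int n\<close> by auto
    then show ?thesis by linarith
  qed
  ultimately show "y \<in> {a..b}" using t by simp
qed auto

text \<open>A polynomial majorant of a closed arc with almost the right mean. The functions
  \<open>max 0 (1 - n * dist(z, arc))\<close> decrease to the indicator of the arc, so by dominated convergence one
  of them has almost the right mean; it is then approximated uniformly by a polynomial, which is
  shifted up so as to stay a majorant.\<close>

lemma trig_poly_approx_arc:
  fixes a b e :: real
  assumes ab: "0 \<le> a" "a \<le> b" "b \<le> 1" and e: "0 < e"
  obtains g :: "complex \<Rightarrow> real" where "real_polynomial_function g"
    "\<And>y. 0 \<le> g (cis (2 * pi * y))"
    "\<And>y. y \<in> {a..b} \<Longrightarrow> 1 \<le> g (cis (2 * pi * y))"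
    "integral {0..1} (\<lambda>y. g (cis (2 * pi * y))) \<le> b - a + e"
proof -
  define Arc where "Arc = (\<lambda>t. cis (2 * pi * t)) ` {a..b}"
  have cts_cis: "continuous_on A (\<lambda>t. cis (2 * pi * t))" for A
    by (intro continuous_intros)
  have "compact Arc"
    unfolding Arc_def by (intro compact_continuous_image cts_cis) auto
  then have closed: "closed Arc" by (rule compact_imp_closed)
  have ne: "Arc \<noteq> {}" using ab by (auto simp: Arc_def)
  define F where "F n z = max 0 (1 - real n * infdist z Arc)" for n z
  have F01: "0 \<le> F n z" "F n z \<le> 1" for n z
    using infdist_nonneg[of z Arc] by (auto simp: F_def)
  have F1: "F n z = 1" if "z \<in> Arc" for n z
    using that by (simp add: F_def)
  have cts_F: "continuous_on A (F n)" for A n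
    unfolding F_def by (intro continuous_intros)
  have cts_Fc: "continuous_on A (\<lambda>y. F n (cis (2 * pi * y)))" for A n
    by (rule continuous_on_compose2[OF cts_F cts_cis]) auto
  have lim: "(\<lambda>n. F n z) \<longlonglongrightarrow> indicator Arc z" for z
  proof (cases "z \<in> Arc")
    case True
    then show ?thesis by (simp add: F1)
  next
    case False
    then have pos: "infdist z Arc > 0"
      using in_closed_iff_infdist_zero[OF closed ne, of z] infdist_nonneg[of z Arc] by simp
    have "\<forall>\<^sub>F n in sequentially. real n > 1 / infdist z Arc"
      using filterlim_real_sequentially by (auto simp: filterlim_at_top_dense)
    then have "\<forall>\<^sub>F n in sequentially. F n z = 0"
      by eventually_elim (use pos in \<open>auto simp: F_def field_simps\<close>)
    then show ?thesis using False by (simp add: tendsto_eventually)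
  qed
  have "(\<lambda>n. integral {0..1} (\<lambda>y. F n (cis (2 * pi * y))))
      \<longlonglongrightarrow> integral {0..1} (\<lambda>y. indicator Arc (cis (2 * pi * y)))"
    by (rule dominated_convergence(2)[where h = "\<lambda>_. 1"])
       (auto simp: F01 lim intro!: integrable_continuous_real cts_Fc)
  also have "integral {0..1} (\<lambda>y. indicator Arc (cis (2 * pi * y)) :: real) = b - a"
  proof (rule integral_unique)
    have "((\<lambda>y. 1) has_integral (b - a)) {a..b}"
      using has_integral_const_real[of "1::real" a b] ab by simp
    then have "((\<lambda>y. if y \<in> {a..b} then 1 else 0) has_integral (b - a)) {0..1::real}"
      using ab by (subst has_integral_restrict) auto
    then show "((\<lambda>y. indicator Arc (cis (2 * pi * y))) has_integral b - a) {0..1::real}"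
    proof (rule has_integral_spike_finite[where S = "{0, 1}", rotated 2])
      fix y :: real assume "y \<in> {0..1} - {0, 1}"
      then show "indicator Arc (cis (2 * pi * y)) = (if y \<in> {a..b} then 1 else (0::real))"
        using cis_2pi_in_arc_iff[of a b y] ab by (auto simp: Arc_def indicator_def)
    qed auto
  qed
  finally have "\<forall>\<^sub>F n in sequentially. integral {0..1} (\<lambda>y. F n (cis (2 * pi * y))) < b - a + e / 3"
    using e by (intro order_tendstoD) auto
  then obtain n where n: "integral {0..1} (\<lambda>y. F n (cis (2 * pi * y))) < b - a + e / 3"
    by (auto simp: eventually_sequentially)
  obtain g :: "complex \<Rightarrow> real" where g: "real_polynomial_function g"
    and gF: "\<And>z. z \<in> sphere 0 1 \<Longrightarrow> \<bar>F n z - g z\<bar> < e / 3"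
    using Stone_Weierstrass_real_polynomial_function[OF compact_sphere cts_F, of "e/3"] e
    by (metis divide_pos_pos zero_less_numeral)
  have gF': "\<bar>F n (cis (2 * pi * y)) - g (cis (2 * pi * y))\<bar> < e / 3" for y
    by (rule gF) simp
  have cts_g: "continuous_on A (\<lambda>y. g (cis (2 * pi * y)))" for A
    by (rule continuous_on_compose2[OF _ cts_cis, of UNIV])
       (use g in \<open>auto intro: continuous_on_polymonial_function simp: real_polynomial_function_eq\<close>)
  have "integral {0..1} (\<lambda>y. g (cis (2 * pi * y)) + e / 3)
      \<le> integral {0..1} (\<lambda>y. F n (cis (2 * pi * y)) + 2 * e / 3)"
  proof (rule integral_le)
    fix y :: real
    show "g (cis (2 * pi * y)) + e / 3 \<le> F n (cis (2 * pi * y)) + 2 * e / 3"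
      using gF'[of y] by linarith
  qed (intro integrable_continuous_real continuous_intros cts_g cts_Fc)+
  also have "\<dots> = integral {0..1} (\<lambda>y. F n (cis (2 * pi * y))) + 2 * e / 3"
    by (subst integral_add) (auto intro!: integrable_continuous_real cts_Fc)
  also have "\<dots> \<le> b - a + e" using n by linarith
  finally have int: "integral {0..1} (\<lambda>y. g (cis (2 * pi * y)) + e / 3) \<le> b - a + e" .
  show ?thesis
  proof (rule that[of "\<lambda>z. g z + e / 3"])
    show "real_polynomial_function (\<lambda>z. g z + e / 3)"
      by (rule real_polynomial_function.intros(3)[OF g real_polynomial_function.intros(2)])
    show "0 \<le> g (cis (2 * pi * y)) + e / 3" for y
      using gF'[of y] F01(1)[of n "cis (2 * pi * y)"] by linarith
    show "1 \<le> g (cis (2 * pi * y)) + e / 3" if "y \<in> {a..b}" for y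
      proof -
      have "F n (cis (2 * pi * y)) = 1" using that by (intro F1) (auto simp: Arc_def)
      then show ?thesis using gF'[of y] by linarith
    qed
  qed fact
qed

lemma cis_2pi_frac: "cis (2 * pi * of_int m * frac y) = cis (2 * pi * of_int m * y)"
proof -
  have "cis (2 * pi * of_int m * y)
      = cis (2 * pi * of_int m * frac y + 2 * pi * of_int (m * \<lfloor>y\<rfloor>))"
    by (rule arg_cong[where f = cis]) (simp add: frac_def algebra_simps)
  also have "\<dots> = cis (2 * pi * of_int m * frac y) * cis (2 * pi * of_int (m * \<lfloor>y\<rfloor>))"
    by (simp only: cis_mult)
  also have "cis (2 * pi * of_int (m * \<lfloor>y\<rfloor>)) = 1"
    by (rule cis_multiple_2pi) simp
  finally show ?thesis by simp
qed

lemma weyl_upper_bound: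
  fixes a b e :: real
  assumes ab: "0 \<le> a" "a \<le> b" "b \<le> 1" and e: "0 < e"
  shows "\<exists>C F. 0 \<le> C \<and> finite F \<and> 0 \<notin> F \<and>
    (\<forall>S y. finite (S :: 'i set) \<longrightarrow> real (card {v \<in> S. frac (y v) \<in> {a..b}})
       \<le> (b - a + e) * card S + C * (\<Sum>m\<in>F. cmod (\<Sum>v\<in>S. cis (2 * pi * of_int m * y v))))"
proof -
  obtain g :: "complex \<Rightarrow> real" where g: "real_polynomial_function g"
    and g0: "\<And>y. 0 \<le> g (cis (2 * pi * y))"
    and g1: "\<And>y. y \<in> {a..b} \<Longrightarrow> 1 \<le> g (cis (2 * pi * y))"
    and gint: "integral {0..1} (\<lambda>y. g (cis (2 * pi * y))) \<le> b - a + e"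
    using trig_poly_approx_arc[OF ab e] by metis
  define h where "h y = complex_of_real (g (cis (2 * pi * y)))" for y
  have "trig_poly h"
    unfolding h_def by (rule trig_poly_real_polynomial_function[OF g])
  then obtain I C F where
    f: "(h has_integral I) {0..1}" "0 \<le> C" "finite F" "0 \<notin> F" "\<And>S y. finite (S :: 'i set) \<Longrightarrow>
       cmod ((\<Sum>v\<in>S. h (y v)) - of_nat (card S) * I)
         \<le> C * (\<Sum>m\<in>F. cmod (\<Sum>v\<in>S. cis (2 * pi * of_int m * y v)))"
    using trig_poly_sum_bound[where ?'i = 'i] by metis
  have "((Re \<circ> h) has_integral Re I) {0..1}"
    by (rule has_integral_linear[OF f(1) bounded_linear_Re])
  then have "integral {0..1} (\<lambda>y. g (cis (2 * pi * y))) = Re I"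
    by (intro integral_unique) (simp add: h_def o_def)
  then have I: "Re I \<le> b - a + e" using gint by simp
  show ?thesis
  proof (intro exI conjI allI impI)
    fix S :: "'i set" and y :: "'i \<Rightarrow> real" assume S: "finite S"
    let ?W = "\<Sum>m\<in>F. cmod (\<Sum>v\<in>S. cis (2 * pi * of_int m * y v))"
    have gf: "g (cis (2 * pi * frac t)) = g (cis (2 * pi * t))" for t
      using cis_2pi_frac[of 1 t] by simp
    have "real (card {v \<in> S. frac (y v) \<in> {a..b}}) = (\<Sum>v\<in>S. if frac (y v) \<in> {a..b} then 1 else 0)"
      using S by (simp add: sum.If_cases Int_def)
    also have "\<dots> \<le> (\<Sum>v\<in>S. g (cis (2 * pi * y v)))"
    proof (rule sum_mono)
      fix v
      show "(if frac (y v) \<in> {a..b} then 1 else 0) \<le> g (cis (2 * pi * y v))"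
        using g0[of "y v"] g1[of "frac (y v)"] gf[of "y v"] by auto
    qed
    also have "\<dots> = Re (of_nat (card S) * I) + Re ((\<Sum>v\<in>S. h (y v)) - of_nat (card S) * I)"
      by (simp add: h_def)
    also have "\<dots> \<le> Re (of_nat (card S) * I) + C * ?W"
      using complex_Re_le_cmod[of "(\<Sum>v\<in>S. h (y v)) - of_nat (card S) * I"] f(5)[OF S, of y]
      by linarith
    also have "Re (of_nat (card S) * I) \<le> (b - a + e) * card S"
      using mult_right_mono[OF I, of "real (card S)"] by (simp add: mult_ac)
    finally show "real (card {v \<in> S. frac (y v) \<in> {a..b}}) \<le> (b - a + e) * card S + C * ?W"
      by simp
  qed (use f in auto)
qed

text \<open>The lower bound is the upper bound for the complementary arc \<open>[\<alpha>, 1]\<close>.\<close>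

lemma weyl_bound:
  fixes \<alpha> e :: real
  assumes \<alpha>: "0 \<le> \<alpha>" "\<alpha> \<le> 1" and e: "0 < e"
  shows "\<exists>C F. 0 \<le> C \<and> finite F \<and> 0 \<notin> F \<and>
    (\<forall>S y. finite (S :: 'i set) \<longrightarrow> \<bar>real (card {v \<in> S. frac (y v) \<le> \<alpha>}) - \<alpha> * card S\<bar>
       \<le> e * card S + C * (\<Sum>m\<in>F. cmod (\<Sum>v\<in>S. cis (2 * pi * of_int m * y v))))"
proof -
  obtain C F where
    f: "0 \<le> C" "finite F" "0 \<notin> F" "\<And>S y. finite (S :: 'i set) \<Longrightarrow>
       real (card {v \<in> S. frac (y v) \<in> {0..\<alpha>}})
         \<le> (\<alpha> - 0 + e) * card S + C * (\<Sum>m\<in>F. cmod (\<Sum>v\<in>S. cis (2 * pi * of_int m * y v)))"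
    using weyl_upper_bound[of 0 \<alpha> e, where ?'i = 'i] assms by auto
  obtain C' F' where
    f': "0 \<le> C'" "finite F'" "0 \<notin> F'" "\<And>S y. finite (S :: 'i set) \<Longrightarrow>
       real (card {v \<in> S. frac (y v) \<in> {\<alpha>..1}})
         \<le> (1 - \<alpha> + e) * card S + C' * (\<Sum>m\<in>F'. cmod (\<Sum>v\<in>S. cis (2 * pi * of_int m * y v)))"
    using weyl_upper_bound[of \<alpha> 1 e, where ?'i = 'i] assms by auto
  show ?thesis
  proof (intro exI conjI allI impI)
    show "0 \<le> C + C'" "finite (F \<union> F')" "0 \<notin> F \<union> F'" using f f' by auto
    fix S :: "'i set" and y assume S: "finite S"
    let ?W = "\<lambda>F. \<Sum>m\<in>F. cmod (\<Sum>v\<in>S. cis (2 * pi * of_int m * y v))"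
    have mono: "C * ?W F \<le> C * ?W (F \<union> F')" "C' * ?W F' \<le> C' * ?W (F \<union> F')"
      and nn: "0 \<le> C * ?W (F \<union> F')" "0 \<le> C' * ?W (F \<union> F')"
      using f f' by (auto intro!: mult_left_mono sum_mono2 mult_nonneg_nonneg sum_nonneg)
    have up: "real (card {v \<in> S. frac (y v) \<le> \<alpha>}) \<le> (\<alpha> + e) * card S + C * ?W F"
      using f(4)[OF S, of y] by (simp add: frac_ge_0)
    have "card S = card {v \<in> S. frac (y v) \<le> \<alpha>} + card {v \<in> S. \<not> frac (y v) \<le> \<alpha>}"
      using S by (subst card_Un_disjoint[symmetric]) (auto intro: arg_cong[where f = card])
    moreover have "card {v \<in> S. \<not> frac (y v) \<le> \<alpha>} \<le> card {v \<in> S. frac (y v) \<in> {\<alpha>..1}}"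
      using S by (intro card_mono) (auto intro: less_imp_le[OF frac_lt_1])
    ultimately have "real (card S) - card {v \<in> S. frac (y v) \<le> \<alpha>} \<le> (1 - \<alpha> + e) * card S + C' * ?W F'"
      using f'(4)[OF S, of y] by linarith
    then show "\<bar>real (card {v \<in> S. frac (y v) \<le> \<alpha>}) - \<alpha> * card S\<bar>
       \<le> e * card S + (C + C') * ?W (F \<union> F')"
      using up mono nn by (simp add: algebra_simps abs_le_iff)
  qed
qed

section \<open>Characters of a single gap\<close>

text \<open>The character \<open>x \<mapsto> x\<^sup>i\<^sup>t\<close> of the multiplicative group of positive reals. For
  \<open>t = 2 * pi * m / ln B\<close> it is the \<open>m\<close>-th harmonic of \<open>log B x\<close> modulo \<open>1\<close>.\<close>

definition char_at :: "real \<Rightarrow> real \<Rightarrow> complex" where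
  "char_at t x = cis (t * ln x)"

lemma norm_char_at [simp]: "cmod (char_at t x) = 1"
  by (simp add: char_at_def)

lemma char_at_mult: "0 < x \<Longrightarrow> 0 < y \<Longrightarrow> char_at t (x * y) = char_at t x * char_at t y"
  by (simp add: char_at_def ln_mult cis_mult distrib_left)

lemma measurable_char_at [measurable]: "char_at t \<in> borel_measurable borel"
proof -
  have "cis \<in> borel_measurable borel"
    by (intro borel_measurable_continuous_onI continuous_intros)
  then show ?thesis
    unfolding char_at_def by measurable
qed

text \<open>A level set of a character is empty or a two-sided geometric progression. Being a null set, it cannot carry a
  law that has a density.\<close>

lemma countable_char_at_level:
  assumes "t \<noteq> 0"
  shows "countable {x. 0 < x \<and> char_at t x = c}"
proof (rule countable_subset)
  show "{x. 0 < x \<and> char_at t x = c} \<subseteq> range (\<lambda>n::int. exp ((Arg c + 2 * pi * of_int n) / t))"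
  proof safe
    fix x :: real assume x: "0 < x"
    define z where "z = char_at t x"
    have "cis (t * ln x) = cis (Arg z)"
    proof -
      have "z \<noteq> 0" "sgn z = z" by (auto simp: z_def sgn_eq char_at_def)
      then show ?thesis using cis_Arg[of z] by (simp add: z_def char_at_def)
    qed
    then have "cos (t * ln x) = cos (Arg z)" "sin (t * ln x) = sin (Arg z)"
      by (auto simp: complex_eq_iff)
    then obtain n where "t * ln x = Arg z + 2 * pi * of_int n"
      using sin_cos_eq_iff[of "t * ln x" "Arg z"] by (auto simp: mult_ac)
    then have "ln x = (Arg z + 2 * pi * of_int n) / t"
      using assms by (simp add: field_simps)
    then have "x = exp ((Arg z + 2 * pi * of_int n) / t)"
      using x by (metis exp_ln)
    then show "x \<in> range (\<lambda>n::int. exp ((Arg (char_at t x) + 2 * pi * of_int n) / t))"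
      by (auto simp: z_def)
  qed
qed auto

text \<open>Equality in the triangle inequality: the mean of \<open>|Z - E Z|\<^sup>2\<close> is \<open>1 - |E Z|\<^sup>2 = 0\<close>.\<close>

lemma (in prob_space) unit_modulus_expectation_eq_1:
  fixes Z :: "'a \<Rightarrow> complex"
  assumes [measurable]: "Z \<in> borel_measurable M"
    and Z: "\<And>\<omega>. cmod (Z \<omega>) = 1" and E: "cmod (expectation Z) = 1"
  shows "AE \<omega> in M. Z \<omega> = expectation Z"
proof -
  define c where "c = expectation Z"
  have iZ: "integrable M Z"
    by (rule integrable_const_bound[of _ 1]) (auto simp: Z)
  have c2: "cnj c * c = 1"
    using E complex_norm_square[of c] by (simp add: c_def mult.commute)
  have eq: "(cmod (Z \<omega> - c))\<^sup>2 = 2 - 2 * Re (cnj c * Z \<omega>)" for \<omega>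
  proof -
    have "(cmod (Z \<omega>))\<^sup>2 = 1" "(cmod c)\<^sup>2 = 1" using Z E by (auto simp: c_def)
    moreover have "(cmod (Z \<omega> - c))\<^sup>2 = (cmod (Z \<omega>))\<^sup>2 + (cmod c)\<^sup>2 - 2 * Re (cnj c * Z \<omega>)"
      by (simp only: cmod_power2) (simp add: power2_eq_square algebra_simps)
    ultimately show ?thesis by simp
  qed
  have "expectation (\<lambda>\<omega>. (cmod (Z \<omega> - c))\<^sup>2) = 2 - 2 * Re (cnj c * expectation Z)"
    unfolding eq using iZ by (simp add: prob_space)
  also have "\<dots> = 0" using c2 by (simp add: c_def)
  finally have "expectation (\<lambda>\<omega>. (cmod (Z \<omega> - c))\<^sup>2) = 0" .
  moreover have "integrable M (\<lambda>\<omega>. (cmod (Z \<omega> - c))\<^sup>2)"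
    unfolding eq using iZ by auto
  ultimately have "AE \<omega> in M. (cmod (Z \<omega> - c))\<^sup>2 = 0"
    by (subst integral_nonneg_eq_0_iff_AE[symmetric]) auto
  then show ?thesis by eventually_elim (auto simp: c_def)
qed

context
  fixes d :: nat and D :: "(nat \<Rightarrow> real) measure"
  assumes good: "good_distribution d D"
begin

lemma good_prob_space: "prob_space D"
  using good by (simp add: good_distribution_def)

lemma measurable_gap_good: "i \<le> d \<Longrightarrow> (\<lambda>x. gap d x i) \<in> borel_measurable D"
  using good unfolding good_distribution_def distributed_def by auto

text \<open>Both parts come from the density: it is taken with respect to Lebesgue measure and vanishes to the left of \<open>0\<close>.\<close>

lemma AE_gap_not_in_null_set:
  assumes i: "i \<le> d" and N: "N \<in> null_sets lborel"
  shows "AE x in D. gap d x i \<notin> N \<union> {..<0}"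
proof -
  obtain f where f: "distributed D lborel (\<lambda>x. gap d x i) (\<lambda>t. ennreal (if 0 \<le> t then f t else 0))"
    using good i unfolding good_distribution_def by blast
  have "AE t in density lborel (\<lambda>t. ennreal (if 0 \<le> t then f t else 0)). t \<notin> N \<union> {..<0}"
  proof (subst AE_density)
    have "AE t in lborel. t \<notin> N" by (rule AE_not_in[OF N])
    then show "AE t in lborel. 0 < ennreal (if 0 \<le> t then f t else 0) \<longrightarrow> t \<notin> N \<union> {..<0}"
      by eventually_elim (auto split: if_splits)
  qed (use f in \<open>simp add: distributed_def\<close>)
  then have "AE t in distr D lborel (\<lambda>x. gap d x i). t \<notin> N \<union> {..<0}"
    by (subst distributed_distr_eq_density[OF f])
  moreover have "(\<lambda>x. gap d x i) \<in> D \<rightarrow>\<^sub>M lborel"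
    using f by (simp add: distributed_def)
  ultimately show ?thesis
    by (rule AE_distrD[rotated])
qed

lemma AE_gap_pos:
  assumes "i \<le> d"
  shows "AE x in D. 0 < gap d x i"
proof -
  have "{0::real} \<in> null_sets lborel" by (rule finite_imp_null_set_lborel) simp
  from AE_gap_not_in_null_set[OF assms this] show ?thesis
    by eventually_elim auto
qed

lemma gap_char_lt_1:
  assumes i: "i \<le> d" and t: "t \<noteq> 0"
  shows "cmod (integral\<^sup>L D (\<lambda>x. char_at t (gap d x i))) < 1"
proof -
  interpret prob_space D by (rule good_prob_space)
  have [measurable]: "(\<lambda>x. gap d x i) \<in> borel_measurable D" by (rule measurable_gap_good[OF i])
  define Z where "Z x = char_at t (gap d x i)" for x
  have mZ: "Z \<in> borel_measurable D" unfolding Z_def by measurable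
  have "cmod (expectation Z) \<le> expectation (\<lambda>x. cmod (Z x))"
    by (rule integral_norm_bound)
  also have "\<dots> = 1" by (simp add: Z_def prob_space)
  finally have "cmod (expectation Z) \<le> 1" .
  moreover have "cmod (expectation Z) \<noteq> 1"
  proof
    assume that: "cmod (expectation Z) = 1"
    have "AE x in D. Z x = expectation Z"
      by (rule unit_modulus_expectation_eq_1[OF mZ _ that]) (simp add: Z_def)
    moreover have "{x. 0 < x \<and> char_at t x = expectation Z} \<in> null_sets lborel"
      by (intro countable_imp_null_set_lborel countable_char_at_level t)
    note AE_gap_not_in_null_set[OF i this]
    ultimately have "AE x in D. False"
      using AE_gap_pos[OF i] by eventually_elim (auto simp: Z_def)
    then show False by simp
  qed
  ultimately show ?thesis unfolding Z_def by linarith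
qed

lemma gap_char_uniform_bound:
  assumes t: "t \<noteq> 0"
  obtains \<rho> where "0 \<le> \<rho>" "\<rho> < 1"
    "\<And>i. i \<le> d \<Longrightarrow> cmod (integral\<^sup>L D (\<lambda>x. char_at t (gap d x i))) \<le> \<rho>"
proof
  let ?c = "\<lambda>i. cmod (integral\<^sup>L D (\<lambda>x. char_at t (gap d x i)))"
  let ?\<rho> = "Max (?c ` {..d})"
  show "?\<rho> < 1" using gap_char_lt_1[OF _ t] by (subst Max_less_iff) auto
  show "?c i \<le> ?\<rho>" if "i \<le> d" for i using that by (intro Max_ge) auto
  show "0 \<le> ?\<rho>"
    by (rule order_trans[OF norm_ge_zero[of "integral\<^sup>L D (\<lambda>x. char_at t (gap d x 0))"]])
      (rule Max_ge, auto)
qed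

end

section \<open>Functions that are multiplicative along a path\<close>

text \<open>A quantity that picks up the factor \<open>g i (x u)\<close> whenever the path to \<open>v\<close> leaves the broken stick \<open>u\<close>
  through its \<open>i\<close>-th child is the product over all \<open>u\<close> of \<open>path_factor g v u (x u)\<close>. Both a character of the length
  of \<open>v\<close> and the indicator that \<open>v\<close> is alive have this form; writing them as products indexed by the
  sticks \<open>u\<close>, with the trivial factor off the path, lets independence of the data \<open>x u\<close> act factor by factor, also
  for two paths at once.\<close>

fun path_factor :: "(nat \<Rightarrow> 'x \<Rightarrow> 'c::comm_monoid_mult) \<Rightarrow> stick \<Rightarrow> stick \<Rightarrow> 'x \<Rightarrow> 'c" where
  "path_factor g (j, []) u x = 1"
| "path_factor g (j, i # p) u x = (if u = (j, p) then g i x else path_factor g (j, p) u x)"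

lemma path_factor_ancestor:
  "l < length p \<Longrightarrow> path_factor g (j, p) (j, drop (Suc l) p) x = g (p ! l) x"
proof (induction p arbitrary: l)
  case (Cons i p)
  show ?case
  proof (cases l)
    case (Suc l')
    then have "length (drop (Suc l') p) \<noteq> length p" using Cons.prems by simp
    then have "drop (Suc l') p \<noteq> p" by metis
    then show ?thesis using Suc Cons by simp
  qed simp
qed simp

lemma path_factor_eq_1:
  "(\<And>l. l < length p \<Longrightarrow> u \<noteq> (j, drop (Suc l) p)) \<Longrightarrow> path_factor g (j, p) u x = 1"
proof (induction p)
  case (Cons i p)
  have "u \<noteq> (j, p)" using Cons.prems[of 0] by simp
  moreover have "path_factor g (j, p) u x = 1"
    using Cons.prems[of "Suc _"] by (intro Cons.IH) auto
  ultimately show ?case by simp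
qed simp

text \<open>For fixed \<open>v\<close> and \<open>u\<close> the function \<open>path_factor g v u\<close> is constantly \<open>1\<close> or one of the \<open>g i\<close>, and so
  inherits measurability and bounds from these.\<close>

lemma path_factor_closed:
  assumes "P (\<lambda>_. 1)" "\<And>i. i < k \<Longrightarrow> P (g i)" "v \<in> potential_sticks k R"
  shows "P (path_factor g v u)"
proof -
  have "P (path_factor g (j, p) u)" if "p \<in> lists {..<k}" for j p
    using that
  proof (induction p)
    case Nil
    have "path_factor g (j, []) u = (\<lambda>_. 1)" by (rule ext) simp
    then show ?case using assms(1) by simp
  next
    case (Cons i p)
    have "path_factor g (j, i # p) u = (if u = (j, p) then g i else path_factor g (j, p) u)"
      by (rule ext) simp
    then show ?case using Cons assms(2) by simp
  qed
  then show ?thesis using assms(3) by (cases v) (auto simp: potential_sticks_def)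
qed

definition sticks_below :: "nat \<Rightarrow> nat \<Rightarrow> nat \<Rightarrow> stick set" where
  "sticks_below k R n = {v \<in> potential_sticks k R. length (snd v) < n}"

definition num_words :: "nat \<Rightarrow> nat \<Rightarrow> nat" where
  "num_words k n = card {p \<in> lists {..<k}. length p < n}"

lemma finite_words: "finite {p \<in> lists {..<k::nat}. length p < n}"
  by (rule finite_subset[OF _ finite_lists_length_le[of "{..<k}" n]]) auto

lemma sticks_below_altdef: "sticks_below k R n = {..<R} \<times> {p \<in> lists {..<k}. length p < n}"
  by (auto simp: sticks_below_def potential_sticks_def)

lemma finite_sticks_below: "finite (sticks_below k R n)"
  unfolding sticks_below_altdef by (intro finite_cartesian_product finite_words finite_lessThan)

lemma card_sticks_below: "card (sticks_below k R n) = R * num_words k n"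
  unfolding sticks_below_altdef by (simp add: card_cartesian_product num_words_def)

lemma num_words_mono: "m \<le> n \<Longrightarrow> num_words k m \<le> num_words k n"
  unfolding num_words_def by (intro card_mono finite_words) auto

lemma sticks_below_subset: "sticks_below k R n \<subseteq> potential_sticks k R"
  by (auto simp: sticks_below_def)

lemma potential_sticks_Cons:
  "(j, i # p) \<in> potential_sticks k R \<longleftrightarrow> i < k \<and> (j, p) \<in> potential_sticks k R"
  by (auto simp: potential_sticks_def)

lemma potential_sticks_drop:
  "(j, p) \<in> potential_sticks k R \<Longrightarrow> (j, drop l p) \<in> potential_sticks k R"
  by (auto simp: potential_sticks_def dest: in_set_dropD)

lemma finite_potential_subset_below:
  assumes "finite S" "S \<subseteq> potential_sticks k R"
  obtains n where "S \<subseteq> sticks_below k R n"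
proof
  show "S \<subseteq> sticks_below k R (Suc (Max ((length \<circ> snd) ` S)))"
    using assms by (auto simp: sticks_below_def less_Suc_eq_le intro!: Max_ge)
qed

lemma prod_path_factor_Cons:
  assumes "finite U" "(j, p) \<in> U"
  shows "(\<Prod>u\<in>U. path_factor g (j, i # p) u (x u)) =
    (\<Prod>u\<in>U. path_factor g (j, p) u (x u)) * g i (x (j, p))"
proof -
  have self: "path_factor g (j, p) (j, p) y = 1" for y
  proof (rule path_factor_eq_1)
    fix l assume "l < length p"
    then have "length (drop (Suc l) p) \<noteq> length p" by simp
    then show "(j, p) \<noteq> (j, drop (Suc l) p)" by (metis prod.inject)
  qed
  have "(\<Prod>u\<in>U. path_factor g (j, i # p) u (x u)) =
     (\<Prod>u\<in>U. path_factor g (j, p) u (x u) * (if u = (j, p) then g i (x (j, p)) else 1))"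
    by (intro prod.cong) (auto simp: self)
  also have "\<dots> = (\<Prod>u\<in>U. path_factor g (j, p) u (x u)) * g i (x (j, p))"
    using assms by (simp add: prod.distrib)
  finally show ?thesis .
qed

lemma alive_eq_prod:
  assumes "v \<in> sticks_below k R (Suc n)"
  shows "of_bool (alive A \<omega> v) =
    (\<Prod>u\<in>sticks_below k R n. path_factor (\<lambda>i a. of_bool (a i) :: 'c::comm_semiring_1) v u (A u \<omega>))"
proof -
  have "of_bool (alive A \<omega> (j, p)) =
    (\<Prod>u\<in>sticks_below k R n. path_factor (\<lambda>i a. of_bool (a i) :: 'c) (j, p) u (A u \<omega>))"
    if "(j, p) \<in> sticks_below k R (Suc n)" for j p
    using that
  proof (induction p)
    case (Cons i p)
    then have "(j, p) \<in> sticks_below k R n"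
      by (auto simp: sticks_below_def potential_sticks_Cons)
    moreover from this have "(j, p) \<in> sticks_below k R (Suc n)"
      by (auto simp: sticks_below_def)
    ultimately show ?case
      by (simp only: prod_path_factor_Cons[OF finite_sticks_below] Cons.IH[symmetric])
         (simp add: of_bool_conj)
  qed simp
  then show ?thesis using assms by (cases v) auto
qed

lemma stick_length_pos_and_char:
  assumes "v \<in> sticks_below k R (Suc n)" "0 < L"
    and "\<And>u i. u \<in> sticks_below k R n \<Longrightarrow> i < k \<Longrightarrow> 0 < gap (k - 1) (X u \<omega>) i"
  shows "0 < stick_length k L X \<omega> v \<and> char_at t (stick_length k L X \<omega> v) =
    char_at t L *
    (\<Prod>u\<in>sticks_below k R n. path_factor (\<lambda>i x. char_at t (gap (k - 1) x i)) v u (X u \<omega>))"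
proof -
  have "0 < stick_length k L X \<omega> (j, p) \<and> char_at t (stick_length k L X \<omega> (j, p)) =
    char_at t L *
    (\<Prod>u\<in>sticks_below k R n. path_factor (\<lambda>i x. char_at t (gap (k - 1) x i)) (j, p) u (X u \<omega>))"
    if "(j, p) \<in> sticks_below k R (Suc n)" for j p
    using that
  proof (induction p)
    case (Cons i p)
    then have p: "(j, p) \<in> sticks_below k R n" and i: "i < k"
      by (auto simp: sticks_below_def potential_sticks_Cons)
    then have "(j, p) \<in> sticks_below k R (Suc n)"
      by (auto simp: sticks_below_def)
    then show ?case
      using Cons.IH assms(3)[OF p i]
      by (simp add: prod_path_factor_Cons[OF finite_sticks_below p] char_at_mult
          del: path_factor.simps)
  qed (use assms in simp)
  then show ?thesis using assms(1) by (cases v) auto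
qed

lemma (in prob_space) expectation_prod_path_factors:
  fixes g h :: "nat \<Rightarrow> 'x \<Rightarrow> 'c::{real_normed_field, banach, second_countable_topology}"
  assumes indep: "indep_vars (\<lambda>_. D) X (potential_sticks k R)"
    and g: "\<And>i. i < k \<Longrightarrow> g i \<in> borel_measurable D" "\<And>i x. i < k \<Longrightarrow> norm (g i x) \<le> 1"
    and h: "\<And>i. i < k \<Longrightarrow> h i \<in> borel_measurable D" "\<And>i x. i < k \<Longrightarrow> norm (h i x) \<le> 1"
    and U: "finite U" "U \<subseteq> potential_sticks k R"
    and v: "v \<in> potential_sticks k R" and w: "w \<in> potential_sticks k R"
  defines "f \<equiv> \<lambda>u x. path_factor g v u x * path_factor h w u x"
  shows "expectation (\<lambda>\<omega>. \<Prod>u\<in>U. f u (X u \<omega>)) = (\<Prod>u\<in>U. expectation (\<lambda>\<omega>. f u (X u \<omega>)))"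
    and "\<And>u. u \<in> U \<Longrightarrow> integrable M (\<lambda>\<omega>. f u (X u \<omega>))"
    and "\<And>u x. norm (f u x) \<le> 1"
proof -
  have [measurable]: "path_factor g v u \<in> borel_measurable D" "path_factor h w u \<in> borel_measurable D" for u
    using path_factor_closed[where P = "\<lambda>f. f \<in> borel_measurable D", of k g v R]
      path_factor_closed[where P = "\<lambda>f. f \<in> borel_measurable D", of k h w R] g h v w by auto
  have mf: "f u \<in> borel_measurable D" for u unfolding f_def by measurable
  have nrm: "\<forall>x. norm (path_factor g v u x) \<le> 1" "\<forall>x. norm (path_factor h w u x) \<le> 1" for u
    using path_factor_closed[where P = "\<lambda>f. \<forall>x. norm (f x) \<le> 1", of k g v R]
      path_factor_closed[where P = "\<lambda>f. \<forall>x. norm (f x) \<le> 1", of k h w R] g h v w by auto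
  show bd: "norm (f u x) \<le> 1" for u x
    using nrm[of u] unfolding f_def norm_mult by (intro mult_le_one) simp_all
  have ind: "indep_vars (\<lambda>_. borel) (\<lambda>u \<omega>. f u (X u \<omega>)) U"
    by (rule indep_vars_compose2[OF indep_vars_subset[OF indep U(2)] mf])
  then have meas: "(\<lambda>\<omega>. f u (X u \<omega>)) \<in> borel_measurable M" if "u \<in> U" for u
    using that by (auto simp: indep_vars_def)
  show int: "integrable M (\<lambda>\<omega>. f u (X u \<omega>))" if "u \<in> U" for u
    by (rule integrable_const_bound[of _ 1]) (use meas[OF that] bd in auto)
  show "expectation (\<lambda>\<omega>. \<Prod>u\<in>U. f u (X u \<omega>)) = (\<Prod>u\<in>U. expectation (\<lambda>\<omega>. f u (X u \<omega>)))"
    by (rule indep_vars_lebesgue_integral[OF U(1) ind int])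
qed

section \<open>Decay of correlations between two sticks\<close>

text \<open>If one of the \<open>K\<close> closest ancestors of \<open>v = (j, p)\<close> were above \<open>w = (j', q)\<close>, then \<open>w\<close> would descend
  from the \<open>K\<close>-th ancestor \<open>(j, drop K p)\<close> of \<open>v\<close> as well; not being deeper than \<open>v\<close>, it would do so in at
  most \<open>K\<close> steps.\<close>

lemma path_factor_separate:
  assumes K: "K \<le> length p" and len: "length q \<le> length p"
    and p: "(j, p) \<in> potential_sticks k R" and q: "(j', q) \<in> potential_sticks k R"
    and sep: "\<And>e. e \<in> lists {..<k} \<Longrightarrow> length e \<le> K \<Longrightarrow> (j', q) \<noteq> (j, e @ drop K p)"
    and l: "l < K"
  shows "path_factor h (j', q) (j, drop (Suc l) p) x = 1"
proof (rule path_factor_eq_1, rule notI)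
  fix l' assume l': "l' < length q" and eq: "(j, drop (Suc l) p) = (j', drop (Suc l') q)"
  \<comment> \<open>the path from the \<open>K\<close>-th ancestor of \<open>(j, p)\<close> to \<open>(j', q)\<close>,
      through the common ancestor \<open>(j, drop (Suc l) p)\<close>\<close>
  define e where "e = take (Suc l') q @ take (K - Suc l) (drop (Suc l) p)"
  have "drop (Suc l) p = take (K - Suc l) (drop (Suc l) p) @ drop K p"
    using l append_take_drop_id[of "K - Suc l" "drop (Suc l) p"] by (simp add: drop_drop)
  then have qe: "q = e @ drop K p"
    using eq append_take_drop_id[of "Suc l'" q] by (simp add: e_def)
  then have "length q = length e + (length p - K)"
    by (metis length_append length_drop)
  then have "length e \<le> K" using len K by linarith
  moreover have "e \<in> lists {..<k}"
    using q qe by (auto simp: potential_sticks_def)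
  ultimately show False using sep[of e] eq qe by simp
qed

lemma stick_length_measurable:
  assumes k: "1 \<le> k" and good: "good_distribution (k - 1) D"
    and X: "\<And>v. v \<in> potential_sticks k R \<Longrightarrow> X v \<in> M \<rightarrow>\<^sub>M D"
    and v: "v \<in> potential_sticks k R"
  shows "(\<lambda>\<omega>. stick_length k L X \<omega> v) \<in> borel_measurable M"
proof -
  have "(\<lambda>\<omega>. stick_length k L X \<omega> (j, p)) \<in> borel_measurable M"
    if "(j, p) \<in> potential_sticks k R" for j p
    using that
  proof (induction p)
    case (Cons i p)
    then have i: "i < k" and p: "(j, p) \<in> potential_sticks k R"
      by (auto simp: potential_sticks_Cons)
    have "(\<lambda>\<omega>. gap (k - 1) (X (j, p) \<omega>) i) \<in> borel_measurable M"
      using i by (intro measurable_compose[OF X[OF p]] measurable_gap_good[OF good]) simp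
    with Cons.IH[OF p] show ?case by simp
  qed simp
  then show ?thesis using v by (cases v) auto
qed

locale good_fragmentation = fragmentation +
  assumes k_ge_1: "1 \<le> k" and good: "good_distribution (k - 1) D"
begin

lemma cuts_measurable [measurable]: "v \<in> potential_sticks k R \<Longrightarrow> X v \<in> M \<rightarrow>\<^sub>M D"
  using cuts_indep by (auto simp: indep_vars_def)

lemma gap_measurable: "i < k \<Longrightarrow> (\<lambda>x. gap (k - 1) x i) \<in> borel_measurable D"
  by (rule measurable_gap_good[OF good]) simp

lemma AE_gaps_pos:
  "AE \<omega> in M. \<forall>u\<in>sticks_below k R n. \<forall>i<k. 0 < gap (k - 1) (X u \<omega>) i"
proof -
  have "AE \<omega> in M. 0 < gap (k - 1) (X u \<omega>) i" if u: "u \<in> potential_sticks k R" and i: "i < k" for u i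
  proof -
    have "AE x in distr M D (X u). 0 < gap (k - 1) x i"
      unfolding cuts_law[OF u] using AE_gap_pos[OF good, of i] i by simp
    then show ?thesis by (rule AE_distrD[OF cuts_measurable[OF u]])
  qed
  then show ?thesis
    using finite_sticks_below[of k R n] sticks_below_subset[of k R n]
    by (auto simp: AE_finite_all AE_all_countable subset_iff)
qed

lemma AE_length_char:
  assumes "0 < L"
  shows "AE \<omega> in M. \<forall>v\<in>sticks_below k R (Suc n). 0 < stick_length k L X \<omega> v \<and>
    char_at t (stick_length k L X \<omega> v) = char_at t L *
    (\<Prod>u\<in>sticks_below k R n. path_factor (\<lambda>i x. char_at t (gap (k - 1) x i)) v u (X u \<omega>))"
  using AE_gaps_pos[of n]
proof eventually_elim
  case (elim \<omega>)
  then show ?case using stick_length_pos_and_char[OF _ assms, of _ k R n X \<omega> t] by blast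
qed

lemma stick_length_random_variable:
  "v \<in> potential_sticks k R \<Longrightarrow> (\<lambda>\<omega>. stick_length k L X \<omega> v) \<in> borel_measurable M"
  by (rule stick_length_measurable[OF k_ge_1 good cuts_measurable])

text \<open>The expectation is a product over the broken sticks \<open>u\<close> of factors of modulus at most \<open>1\<close>. At each
  of the \<open>K\<close> closest ancestors of \<open>(j, p)\<close> the factor comes from the path to \<open>(j, p)\<close> alone, so it is the mean of a
  character of a gap.\<close>

lemma char_length_pair_bound:
  assumes L: "0 < L"
    and \<rho>: "\<And>i. i < k \<Longrightarrow> cmod (integral\<^sup>L D (\<lambda>x. char_at t (gap (k - 1) x i))) \<le> \<rho>"
    and K: "K \<le> length p" and len: "length q \<le> length p"
    and p: "(j, p) \<in> potential_sticks k R" and q: "(j', q) \<in> potential_sticks k R"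
    and sep: "\<And>e. e \<in> lists {..<k} \<Longrightarrow> length e \<le> K \<Longrightarrow> (j', q) \<noteq> (j, e @ drop K p)"
  shows "cmod (expectation (\<lambda>\<omega>. char_at t (stick_length k L X \<omega> (j, p)) *
    cnj (char_at t (stick_length k L X \<omega> (j', q))))) \<le> \<rho> ^ K"
proof -
  define U where "U = sticks_below k R (length p)"
  define g where "g i x = char_at t (gap (k - 1) x i)" for i x
  define h where "h i x = cnj (g i x)" for i x
  define f where "f u x = path_factor g (j, p) u x * path_factor h (j', q) u x" for u x
  have gm: "g i \<in> borel_measurable D" if "i < k" for i
    unfolding g_def using measurable_compose[OF gap_measurable[OF that] measurable_char_at] by simp
  have hm: "h i \<in> borel_measurable D" if "i < k" for i
    unfolding h_def using gm[OF that]
    by (rule measurable_compose) (intro borel_measurable_continuous_onI continuous_intros)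
  have g1: "cmod (g i x) = 1" and h1: "cmod (h i x) = 1" for i x
    by (auto simp: g_def h_def)
  have fin: "finite U" and U: "U \<subseteq> potential_sticks k R"
    unfolding U_def by (rule finite_sticks_below, rule sticks_below_subset)
  have prod_E: "expectation (\<lambda>\<omega>. \<Prod>u\<in>U. f u (X u \<omega>)) = (\<Prod>u\<in>U. expectation (\<lambda>\<omega>. f u (X u \<omega>)))"
    and f_int: "\<And>u. u \<in> U \<Longrightarrow> integrable M (\<lambda>\<omega>. f u (X u \<omega>))"
    and f_le_1: "\<And>u x. cmod (f u x) \<le> 1"
    unfolding f_def
    using expectation_prod_path_factors[OF cuts_indep gm _ hm _ fin U p q] g1 h1 by auto
  have cnj_pf: "path_factor h w u x = cnj (path_factor g w u x)" for w u x
    by (cases w, hypsubst_thin, induct_tac b) (auto simp: h_def)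
  have AE_eq: "AE \<omega> in M. char_at t (stick_length k L X \<omega> (j, p)) * cnj (char_at t (stick_length k L X \<omega> (j', q)))
      = (\<Prod>u\<in>U. f u (X u \<omega>))"
    using AE_length_char[OF L, of "length p" t]
  proof eventually_elim
    case (elim \<omega>)
    have mem: "(j, p) \<in> sticks_below k R (Suc (length p))" "(j', q) \<in> sticks_below k R (Suc (length p))"
      using p q len by (auto simp: sticks_below_def)
    have L1: "char_at t L * cnj (char_at t L) = 1"
      using complex_norm_square[of "char_at t L"] by simp
    show ?case
      using elim[THEN bspec, OF mem(1)] elim[THEN bspec, OF mem(2)] L1
      unfolding U_def f_def cnj_pf g_def[symmetric, abs_def] prod.distrib
      by (simp add: algebra_simps)
  qed
  have "expectation (\<lambda>\<omega>. char_at t (stick_length k L X \<omega> (j, p)) * cnj (char_at t (stick_length k L X \<omega> (j', q))))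
      = expectation (\<lambda>\<omega>. \<Prod>u\<in>U. f u (X u \<omega>))"
  proof (rule integral_cong_AE[OF _ _ AE_eq])
    have [measurable]: "(\<lambda>\<omega>. stick_length k L X \<omega> (j, p)) \<in> borel_measurable M"
      "(\<lambda>\<omega>. stick_length k L X \<omega> (j', q)) \<in> borel_measurable M"
      using stick_length_random_variable p q by auto
    have [measurable]: "cnj \<in> borel_measurable borel"
      by (intro borel_measurable_continuous_onI continuous_intros)
    show "(\<lambda>\<omega>. char_at t (stick_length k L X \<omega> (j, p)) * cnj (char_at t (stick_length k L X \<omega> (j', q))))
      \<in> borel_measurable M" by measurable
    show "(\<lambda>\<omega>. \<Prod>u\<in>U. f u (X u \<omega>)) \<in> borel_measurable M"
      using f_int by (intro borel_measurable_prod borel_measurable_integrable)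
  qed
  also have "\<dots> = (\<Prod>u\<in>U. expectation (\<lambda>\<omega>. f u (X u \<omega>)))" by (rule prod_E)
  finally have eq: "cmod (expectation (\<lambda>\<omega>. char_at t (stick_length k L X \<omega> (j, p)) *
      cnj (char_at t (stick_length k L X \<omega> (j', q))))) = (\<Prod>u\<in>U. cmod (expectation (\<lambda>\<omega>. f u (X u \<omega>))))"
    by (simp add: prod_norm)
  \<comment> \<open>the \<open>K\<close> closest ancestors of \<open>(j, p)\<close>, at each of which only the path to
      \<open>(j, p)\<close> contributes\<close>
  define P where "P = (\<lambda>l. (j, drop (Suc l) p)) ` {..<K}"
  have inj: "inj_on (\<lambda>l. (j, drop (Suc l) p)) {..<K}"
  proof (rule inj_onI)
    fix l l' assume l: "l \<in> {..<K}" "l' \<in> {..<K}" and "(j, drop (Suc l) p) = (j, drop (Suc l') p)"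
    then have "drop (Suc l) p = drop (Suc l') p" by simp
    then have "length (drop (Suc l) p) = length (drop (Suc l') p)" by (rule arg_cong)
    then show "l = l'" using l K by simp
  qed
  have PU: "P \<subseteq> U"
    using p K potential_sticks_drop[OF p] by (auto simp: P_def U_def sticks_below_def)
  have "(\<Prod>u\<in>U. cmod (expectation (\<lambda>\<omega>. f u (X u \<omega>)))) \<le> (\<Prod>u\<in>U. if u \<in> P then \<rho> else 1)"
  proof (intro prod_mono conjI norm_ge_zero)
    fix u assume u: "u \<in> U"
    have "cmod (expectation (\<lambda>\<omega>. f u (X u \<omega>))) \<le> expectation (\<lambda>\<omega>. cmod (f u (X u \<omega>)))"
      by (rule integral_norm_bound)
    also have "\<dots> \<le> expectation (\<lambda>_. 1)"
      by (intro integral_mono integrable_norm f_int u f_le_1) simp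
    finally have le1: "cmod (expectation (\<lambda>\<omega>. f u (X u \<omega>))) \<le> 1" by (simp add: prob_space)
    show "cmod (expectation (\<lambda>\<omega>. f u (X u \<omega>))) \<le> (if u \<in> P then \<rho> else 1)"
    proof (cases "u \<in> P")
      case True
      then obtain l where l: "l < K" "u = (j, drop (Suc l) p)" by (auto simp: P_def)
      have "f u x = g (p ! l) x" for x
        using path_factor_separate[OF K len p q sep l(1), of h x] l K
          path_factor_ancestor[of l p g j x] by (simp add: f_def)
      then have "expectation (\<lambda>\<omega>. f u (X u \<omega>)) = expectation (\<lambda>\<omega>. g (p ! l) (X u \<omega>))" by simp
      also have "\<dots> = integral\<^sup>L (distr M D (X u)) (g (p ! l))"
        using p l K u U by (intro integral_distr[symmetric] gm cuts_measurable)
          (auto simp: potential_sticks_def dest!: nth_mem)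
      also have "\<dots> = integral\<^sup>L D (g (p ! l))" using u U by (subst cuts_law) auto
      finally show ?thesis
        using True \<rho>[of "p ! l"] p l K unfolding g_def[abs_def]
        by (auto simp: potential_sticks_def dest!: nth_mem)
    qed (use le1 in simp)
  qed
  also have "\<dots> = \<rho> ^ card P"
    using fin PU by (simp add: prod.If_cases Int_absorb1)
  also have "card P = K" unfolding P_def using inj by (simp add: card_image)
  finally show ?thesis unfolding eq .
qed

end

section \<open>Second moment of the character sums\<close>

context good_fragmentation
begin

lemma char_length_integrable:
  assumes "v \<in> potential_sticks k R" "w \<in> potential_sticks k R"
  shows "integrable M (\<lambda>\<omega>. char_at t (stick_length k L X \<omega> v) * cnj (char_at t (stick_length k L X \<omega> w)))"
proof (rule integrable_const_bound[of _ 1])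
  have [measurable]: "(\<lambda>\<omega>. stick_length k L X \<omega> v) \<in> borel_measurable M"
    "(\<lambda>\<omega>. stick_length k L X \<omega> w) \<in> borel_measurable M"
    using stick_length_random_variable assms by auto
  have [measurable]: "cnj \<in> borel_measurable borel"
    by (intro borel_measurable_continuous_onI continuous_intros)
  show "(\<lambda>\<omega>. char_at t (stick_length k L X \<omega> v) * cnj (char_at t (stick_length k L X \<omega> w)))
      \<in> borel_measurable M" by measurable
qed (simp add: norm_mult)

text \<open>The descendants of the \<open>K\<close>-th ancestor of \<open>v\<close> (of the initial stick if \<open>v\<close> is not that deep) by at most
  \<open>K\<close> generations. Their number is bounded independently of \<open>v\<close>.\<close>

definition near :: "nat \<Rightarrow> stick \<Rightarrow> stick set" where
  "near K v = (\<lambda>e. (fst v, e @ drop K (snd v))) ` {e \<in> lists {..<k}. length e < Suc K}"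

lemma card_near: "card (near K v \<inter> S) \<le> num_words k (Suc K)"
proof -
  have "card (near K v \<inter> S) \<le> card (near K v)"
    unfolding near_def by (intro card_mono finite_imageI finite_words) auto
  also have "\<dots> \<le> num_words k (Suc K)"
    unfolding near_def num_words_def by (intro card_image_le finite_words)
  finally show ?thesis .
qed

text \<open>The deeper one of \<open>v\<close> and \<open>w\<close> decides: either it has \<open>K\<close> ancestors, and \<open>char_length_pair_bound\<close>
  applies unless the other stick is near, or both sticks are shallow.\<close>

lemma char_length_pair_bound_all:
  assumes L: "0 < L" and \<rho>0: "0 \<le> \<rho>"
    and \<rho>: "\<And>i. i < k \<Longrightarrow> cmod (integral\<^sup>L D (\<lambda>x. char_at t (gap (k - 1) x i))) \<le> \<rho>"
    and v: "v \<in> potential_sticks k R" and w: "w \<in> potential_sticks k R"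
  shows "cmod (expectation (\<lambda>\<omega>. char_at t (stick_length k L X \<omega> v) *
      cnj (char_at t (stick_length k L X \<omega> w))))
    \<le> indicator (near K v) w + indicator (near K w) v + \<rho> ^ K +
      indicator (sticks_below k R K) v * indicator (sticks_below k R K) w" (is "?E v w \<le> _")
proof -
  have far: "?E v w \<le> indicator (near K v) w + \<rho> ^ K"
    if "v \<in> potential_sticks k R" "w \<in> potential_sticks k R"
      and K: "K \<le> length (snd v)" and len: "length (snd w) \<le> length (snd v)" for v w
  proof (cases "w \<in> near K v")
    case True
    have "?E v w \<le> expectation (\<lambda>\<omega>. cmod (char_at t (stick_length k L X \<omega> v) *
        cnj (char_at t (stick_length k L X \<omega> w))))"
      by (rule integral_norm_bound)
    also have "\<dots> = 1" by (simp add: norm_mult prob_space)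
    also have "1 \<le> indicator (near K v) w + \<rho> ^ K"
      using True \<rho>0 by simp
    finally show ?thesis .
  next
    case False
    obtain j p j' q where vw: "v = (j, p)" "w = (j', q)" by (metis surj_pair)
    have "?E v w \<le> \<rho> ^ K"
      unfolding vw
    proof (rule char_length_pair_bound[OF L \<rho>])
      fix e assume "e \<in> lists {..<k}" "length e \<le> K"
      then show "(j', q) \<noteq> (j, e @ drop K p)"
        using False by (auto simp: near_def vw image_iff)
    qed (use that in \<open>auto simp: vw\<close>)
    then show ?thesis using False by simp
  qed
  have sym: "?E v w = ?E w v" for v w
  proof -
    have "expectation (\<lambda>\<omega>. char_at t (stick_length k L X \<omega> w) * cnj (char_at t (stick_length k L X \<omega> v)))
      = expectation (\<lambda>\<omega>. cnj (char_at t (stick_length k L X \<omega> v) * cnj (char_at t (stick_length k L X \<omega> w))))"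
      by (simp add: mult.commute)
    also have "\<dots> = cnj (expectation (\<lambda>\<omega>. char_at t (stick_length k L X \<omega> v) * cnj (char_at t (stick_length k L X \<omega> w))))"
      by (rule Bochner_Integration.integral_cnj)
    finally show ?thesis by simp
  qed
  have nn: "0 \<le> (indicator A x :: real)" for A and x :: stick by simp
  consider "K \<le> length (snd v)" "length (snd w) \<le> length (snd v)"
    | "K \<le> length (snd w)" "length (snd v) \<le> length (snd w)"
    | "length (snd v) < K" "length (snd w) < K" by linarith
  then show ?thesis
  proof cases
    case 1
    show ?thesis using far[OF v w 1] nn[of "near K w" v]
        mult_nonneg_nonneg[OF nn[of "sticks_below k R K" v] nn[of "sticks_below k R K" w]] by linarith
  next
    case 2
    show ?thesis using far[OF w v 2] sym[of v w] nn[of "near K v" w]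
        mult_nonneg_nonneg[OF nn[of "sticks_below k R K" v] nn[of "sticks_below k R K" w]] by linarith
  next
    case 3
    have "?E v w \<le> expectation (\<lambda>\<omega>. cmod (char_at t (stick_length k L X \<omega> v) *
        cnj (char_at t (stick_length k L X \<omega> w))))"
      by (rule integral_norm_bound)
    also have "\<dots> = 1" by (simp add: norm_mult prob_space)
    finally have "?E v w \<le> 1" .
    have "v \<in> sticks_below k R K" "w \<in> sticks_below k R K"
      using 3 v w by (auto simp: sticks_below_def)
    then have "(1::real) \<le> indicator (near K v) w + indicator (near K w) v + \<rho> ^ K +
        indicator (sticks_below k R K) v * indicator (sticks_below k R K) w"
      using \<rho>0 by simp
    with \<open>?E v w \<le> 1\<close> show ?thesis by (rule order_trans)
  qed
qed

text \<open>Summing the bound for pairs: nearness contributes at most \<open>num_words k (Suc K)\<close> for each stick, twice, and the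
  number of shallow sticks is at most \<open>R * num_words k (Suc K)\<close>.\<close>

lemma char_sum_second_moment:
  assumes L: "0 < L" and \<rho>0: "0 \<le> \<rho>"
    and \<rho>: "\<And>i. i < k \<Longrightarrow> cmod (integral\<^sup>L D (\<lambda>x. char_at t (gap (k - 1) x i))) \<le> \<rho>"
    and S: "finite S" "S \<subseteq> potential_sticks k R"
  shows "integrable M (\<lambda>\<omega>. (cmod (\<Sum>v\<in>S. char_at t (stick_length k L X \<omega> v)))\<^sup>2)" (is ?int)
    and "expectation (\<lambda>\<omega>. (cmod (\<Sum>v\<in>S. char_at t (stick_length k L X \<omega> v)))\<^sup>2)
      \<le> 2 * real (num_words k (Suc K)) * card S + \<rho> ^ K * (real (card S))\<^sup>2
        + (real R * real (num_words k (Suc K)))\<^sup>2" (is ?bd)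
proof -
  define \<phi> where "\<phi> v \<omega> = char_at t (stick_length k L X \<omega> v)" for v \<omega>
  define c where "c = real (num_words k (Suc K))"
  have sq: "complex_of_real ((cmod (\<Sum>v\<in>S. \<phi> v \<omega>))\<^sup>2) = (\<Sum>v\<in>S. \<Sum>w\<in>S. \<phi> v \<omega> * cnj (\<phi> w \<omega>))" for \<omega>
    unfolding complex_norm_square by (simp add: sum_product)
  have i1: "integrable M (\<lambda>\<omega>. \<phi> v \<omega> * cnj (\<phi> w \<omega>))" if "v \<in> S" "w \<in> S" for v w
    unfolding \<phi>_def using that S by (intro char_length_integrable) auto
  have "integrable M (\<lambda>\<omega>. complex_of_real ((cmod (\<Sum>v\<in>S. \<phi> v \<omega>))\<^sup>2))"
    unfolding sq by (intro Bochner_Integration.integrable_sum i1)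
  then show int: ?int unfolding complex_of_real_integrable_eq \<phi>_def .
  have "complex_of_real (expectation (\<lambda>\<omega>. (cmod (\<Sum>v\<in>S. \<phi> v \<omega>))\<^sup>2))
      = expectation (\<lambda>\<omega>. complex_of_real ((cmod (\<Sum>v\<in>S. \<phi> v \<omega>))\<^sup>2))"
    by (rule integral_complex_of_real[symmetric])
  also have "\<dots> = (\<Sum>v\<in>S. \<Sum>w\<in>S. expectation (\<lambda>\<omega>. \<phi> v \<omega> * cnj (\<phi> w \<omega>)))"
    unfolding sq by (subst Bochner_Integration.integral_sum, intro Bochner_Integration.integrable_sum i1, assumption+)
      (intro sum.cong refl Bochner_Integration.integral_sum i1)
  finally have "cmod (complex_of_real (expectation (\<lambda>\<omega>. (cmod (\<Sum>v\<in>S. \<phi> v \<omega>))\<^sup>2)))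
      = cmod (\<Sum>v\<in>S. \<Sum>w\<in>S. expectation (\<lambda>\<omega>. \<phi> v \<omega> * cnj (\<phi> w \<omega>)))" by simp
  then have "expectation (\<lambda>\<omega>. (cmod (\<Sum>v\<in>S. \<phi> v \<omega>))\<^sup>2)
      \<le> cmod (\<Sum>v\<in>S. \<Sum>w\<in>S. expectation (\<lambda>\<omega>. \<phi> v \<omega> * cnj (\<phi> w \<omega>)))"
    by simp
  also have "\<dots> \<le> (\<Sum>v\<in>S. \<Sum>w\<in>S. cmod (expectation (\<lambda>\<omega>. \<phi> v \<omega> * cnj (\<phi> w \<omega>))))"
    by (intro sum_norm_le order_refl)
  also have "\<dots> \<le> (\<Sum>v\<in>S. \<Sum>w\<in>S. indicator (near K v) w + indicator (near K w) v + \<rho> ^ K +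
      indicator (sticks_below k R K) v * indicator (sticks_below k R K) w)"
    unfolding \<phi>_def using S by (intro sum_mono char_length_pair_bound_all[OF L \<rho>0 \<rho>]) auto
  also have "\<dots> = (\<Sum>v\<in>S. \<Sum>w\<in>S. indicator (near K v) w) + (\<Sum>v\<in>S. \<Sum>w\<in>S. indicator (near K w) v)
      + \<rho> ^ K * (real (card S))\<^sup>2
      + (\<Sum>v\<in>S. indicator (sticks_below k R K) v) * (\<Sum>v\<in>S. indicator (sticks_below k R K) v)"
    by (simp add: sum.distrib sum_product power2_eq_square mult_ac)
  also have "(\<Sum>v\<in>S. \<Sum>w\<in>S. indicator (near K w) v) = (\<Sum>v\<in>S. \<Sum>w\<in>S. indicator (near K v) w :: real)"
    by (rule sum.swap)
  also have "(\<Sum>v\<in>S. \<Sum>w\<in>S. indicator (near K v) w :: real) \<le> (\<Sum>v\<in>S. c)"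
  proof (rule sum_mono)
    fix v
    have "(\<Sum>w\<in>S. indicator (near K v) w :: real) = card (near K v \<inter> S)"
      using S by (simp add: indicator_def Int_commute Int_def)
    then show "(\<Sum>w\<in>S. indicator (near K v) w :: real) \<le> c"
      using card_near[of K v S] by (simp add: c_def)
  qed
  also have "(\<Sum>v\<in>S. indicator (sticks_below k R K) v :: real) = card (sticks_below k R K \<inter> S)"
    using S by (simp add: indicator_def Int_commute Int_def)
  also have "real (card (sticks_below k R K \<inter> S)) * real (card (sticks_below k R K \<inter> S)) \<le> (real R * c) * (real R * c)"
  proof -
    have "card (sticks_below k R K \<inter> S) \<le> card (sticks_below k R K)"
      by (intro card_mono finite_sticks_below) auto
    also have "\<dots> \<le> R * num_words k (Suc K)"
      unfolding card_sticks_below by (intro mult_le_mono2 num_words_mono) simp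
    finally have "real (card (sticks_below k R K \<inter> S)) \<le> real R * c"
      unfolding c_def of_nat_mult[symmetric] of_nat_le_iff .
    then show ?thesis by (intro mult_mono) (auto simp: c_def)
  qed
  finally show ?bd by (simp add: \<phi>_def c_def power2_eq_square mult_ac)
qed

text \<open>Since \<open>card S\<close> is at least \<open>m\<close> times both \<open>num_words k (Suc K)\<close> and \<open>R * num_words k (Suc K)\<close>, the second
  moment is at most \<open>(3 / m + \<rho> ^ K) * (card S)\<^sup>2\<close>. The first moment follows by \<open>2 a b \<le> a\<^sup>2 + b\<^sup>2\<close>.\<close>

lemma char_sum_first_moment:
  fixes \<eta> :: real
  assumes L: "0 < L" and \<rho>0: "0 \<le> \<rho>"
    and \<rho>: "\<And>i. i < k \<Longrightarrow> cmod (integral\<^sup>L D (\<lambda>x. char_at t (gap (k - 1) x i))) \<le> \<rho>"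
    and S: "finite S" "S \<subseteq> potential_sticks k R" "S \<noteq> {}"
    and m: "1 \<le> m" "real m * real (num_words k (Suc K)) * real R \<le> card S" and R: "1 \<le> R"
    and \<eta>: "0 < \<eta>" "3 / m + \<rho> ^ K \<le> \<eta>\<^sup>2"
  shows "expectation (\<lambda>\<omega>. cmod (\<Sum>v\<in>S. char_at t (stick_length k L X \<omega> v))) \<le> \<eta> * card S"
proof -
  define Z where "Z \<omega> = cmod (\<Sum>v\<in>S. char_at t (stick_length k L X \<omega> v))" for \<omega>
  define c where "c = real (num_words k (Suc K))"
  define n where "n = real (card S)"
  have n: "0 < n" using S by (auto simp: n_def card_gt_0_iff)
  have c0: "0 \<le> c" by (simp add: c_def)
  have second: "integrable M (\<lambda>\<omega>. (Z \<omega>)\<^sup>2)"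
    "expectation (\<lambda>\<omega>. (Z \<omega>)\<^sup>2) \<le> 2 * c * n + \<rho> ^ K * n\<^sup>2 + (real R * c)\<^sup>2"
    using char_sum_second_moment[OF L \<rho>0 \<rho> S(1,2)] unfolding Z_def c_def n_def by auto
  have Rc: "real R * c \<le> n / m"
    using m by (simp add: c_def n_def field_simps)
  have "c \<le> real R * c" using R c0 by (simp add: mult_le_cancel_right1)
  then have cn: "c \<le> n / m" using Rc by linarith
  have "expectation (\<lambda>\<omega>. (Z \<omega>)\<^sup>2) \<le> 2 * c * n + \<rho> ^ K * n\<^sup>2 + (real R * c)\<^sup>2"
    by (rule second(2)) 
  also have "\<dots> \<le> 2 * (n / m) * n + \<rho> ^ K * n\<^sup>2 + (n / m)\<^sup>2"
    using Rc cn c0 n by (intro add_mono mult_left_mono mult_right_mono power_mono order_refl) auto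
  also have "(n / m)\<^sup>2 \<le> n\<^sup>2 / m"
    using m(1) n by (simp add: power2_eq_square field_simps)
  also have "2 * (n / m) * n + \<rho> ^ K * n\<^sup>2 + n\<^sup>2 / m = (3 / m + \<rho> ^ K) * n\<^sup>2"
    by (simp add: power2_eq_square field_simps)
  also have "\<dots> \<le> \<eta>\<^sup>2 * n\<^sup>2" by (intro mult_right_mono \<eta>) simp
  finally have E2: "expectation (\<lambda>\<omega>. (Z \<omega>)\<^sup>2) \<le> (\<eta> * n)\<^sup>2" by (simp add: power_mult_distrib)
  have amgm: "Z \<omega> \<le> \<eta> * n / 2 + (Z \<omega>)\<^sup>2 / (2 * (\<eta> * n))" for \<omega>
  proof -
    have "2 * (\<eta> * n) * Z \<omega> \<le> (\<eta> * n)\<^sup>2 + (Z \<omega>)\<^sup>2"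
      using sum_squares_bound[of "\<eta> * n" "Z \<omega>"] by simp
    then show ?thesis using n \<eta> by (simp add: field_simps power2_eq_square)
  qed
  have "expectation Z \<le> expectation (\<lambda>\<omega>. \<eta> * n / 2 + (Z \<omega>)\<^sup>2 / (2 * (\<eta> * n)))"
  proof (rule integral_mono_AE')
    show "integrable M (\<lambda>\<omega>. \<eta> * n / 2 + (Z \<omega>)\<^sup>2 / (2 * (\<eta> * n)))"
      using second(1) by auto
  qed (use amgm n \<eta> in \<open>auto simp: Z_def intro!: add_nonneg_nonneg\<close>)
  also have "\<dots> = \<eta> * n / 2 + expectation (\<lambda>\<omega>. (Z \<omega>)\<^sup>2) / (2 * (\<eta> * n))"
    using second(1) by (simp add: prob_space)
  also have "\<dots> \<le> \<eta> * n / 2 + (\<eta> * n)\<^sup>2 / (2 * (\<eta> * n))"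
    using E2 n \<eta> by (intro add_left_mono divide_right_mono) auto
  also have "\<dots> = \<eta> * n" using n \<eta> by (simp add: power2_eq_square field_simps)
  finally show ?thesis by (simp add: Z_def[abs_def] n_def)
qed

end

section \<open>Fixed collections of sticks\<close>

lemma significand_eq:
  assumes B: "1 < B" and x: "0 < x"
  shows "significand B x = B powr frac (log B x)"
  unfolding significand_def
proof (rule the_equality)
  have x_eq: "x = B powr frac (log B x) * B powi \<lfloor>log B x\<rfloor>"
  proof -
    have "x = B powr (frac (log B x) + of_int \<lfloor>log B x\<rfloor>)"
      using B x by (simp add: frac_def)
    also have "\<dots> = B powr frac (log B x) * B powi \<lfloor>log B x\<rfloor>"
      using B by (simp add: powr_add powr_real_of_int')
    finally show ?thesis .
  qed
  have "B powr frac (log B x) < B powr 1"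
    using B by (intro powr_less_mono frac_lt_1) auto
  then show "B powr frac (log B x) \<in> {1..<B} \<and> (\<exists>j. x = B powr frac (log B x) * B powi j)"
    using x_eq B ge_one_powr_ge_zero[of B "frac (log B x)"] by auto
  fix t assume "t \<in> {1..<B} \<and> (\<exists>j. x = t * B powi j)"
  then obtain j where t: "1 \<le> t" "t < B" "x = t * B powi j" by auto
  have "log B x = log B t + of_int j"
    using t B by (simp add: log_mult powr_real_of_int'[symmetric])
  moreover have "0 \<le> log B t" "log B t < 1"
    using t B by (auto simp: log_less_iff)
  ultimately have "frac (log B x) = log B t"
    by (simp add: frac_unique_iff)
  then show "t = B powr frac (log B x)" using t B by simp
qed

lemma significand_le_iff:
  assumes "1 < B" "0 < x" "0 < s"
  shows "significand B x \<le> s \<longleftrightarrow> frac (log B x) \<le> log B s"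
  using assms by (simp add: significand_eq le_log_iff)

text \<open>The description in \<open>significand_def\<close> has no solution \<open>t\<close> for \<open>x \<le> 0\<close>, so the significand takes one
  and the same value there.\<close>

lemma borel_measurable_significand:
  assumes B: "1 < B"
  shows "significand B \<in> borel_measurable borel"
proof -
  have neg: "significand B x = significand B 0" if "\<not> 0 < x" for x
  proof -
    have "\<not> (t \<in> {1..<B} \<and> (\<exists>j::int. y = t * B powi j))" if "y \<le> 0" for t y
    proof
      assume *: "t \<in> {1..<B} \<and> (\<exists>j::int. y = t * B powi j)"
      then obtain j :: int where "y = t * B powi j" "1 \<le> t" by auto
      moreover have "0 < B powi j" using B by (intro zero_less_power_int) auto
      ultimately have "0 < y" by (auto intro: mult_pos_pos)
      then show False using that by simp
    qed
    then have "(\<lambda>t. t \<in> {1..<B} \<and> (\<exists>j::int. x = t * B powi j)) = (\<lambda>t. t \<in> {1..<B} \<and> (\<exists>j::int. 0 = t * B powi j))"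
      using that by (auto simp: fun_eq_iff)
    then show ?thesis unfolding significand_def by (rule arg_cong[where f = The])
  qed
  have "significand B = (\<lambda>x. if 0 < x then B powr frac (log B x) else significand B 0)"
  proof
    show "significand B x = (if 0 < x then B powr frac (log B x) else significand B 0)" for x
      using neg[of x] significand_eq[OF B, of x] by (cases "0 < x") simp_all
  qed
  also have "\<dots> \<in> borel_measurable borel"
    unfolding frac_def by measurable
  finally show ?thesis .
qed

text \<open>The threshold \<open>C0\<close> precedes the quantification over the fragmentation processes: it has to
  serve all numbers \<open>R\<close> of initial sticks simultaneously.\<close>

lemma char_sum_uniformly_small:
  assumes k: "1 \<le> k" and good: "good_distribution (k - 1) D" and t: "t \<noteq> 0" and \<eta>: "0 < (\<eta>::real)"
  shows "\<exists>C0::nat. \<forall>(M :: 'a measure) r R X A L S.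
    good_fragmentation M k r D R X A \<longrightarrow> 0 < L \<longrightarrow> 1 \<le> R \<longrightarrow> finite S \<longrightarrow> S \<subseteq> potential_sticks k R \<longrightarrow>
    S \<noteq> {} \<longrightarrow> C0 * R \<le> card S \<longrightarrow>
    integral\<^sup>L M (\<lambda>\<omega>. cmod (\<Sum>v\<in>S. char_at t (stick_length k L X \<omega> v))) \<le> \<eta> * card S"
proof -
  obtain \<rho> where \<rho>: "0 \<le> \<rho>" "\<rho> < 1"
    "\<And>i. i \<le> k - 1 \<Longrightarrow> cmod (integral\<^sup>L D (\<lambda>x. char_at t (gap (k - 1) x i))) \<le> \<rho>"
    using gap_char_uniform_bound[OF good t] by metis
  obtain K where K: "\<rho> ^ K < \<eta>\<^sup>2 / 2"
    using real_arch_pow_inv[of "\<eta>\<^sup>2 / 2" \<rho>] \<eta> \<rho> by auto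
  obtain m :: nat where m: "6 / \<eta>\<^sup>2 < m" using reals_Archimedean2 by blast
  have "0 < 6 / \<eta>\<^sup>2" using \<eta> by simp
  then have m0: "0 < real m" using m by linarith
  have "3 / m < \<eta>\<^sup>2 / 2" using m \<eta> m0 by (simp add: field_simps)
  then have mK: "3 / m + \<rho> ^ K \<le> \<eta>\<^sup>2" using K by linarith
  show ?thesis
  proof (intro exI[of _ "m * num_words k (Suc K)"] allI impI)
    fix M :: "'a measure" and r L :: real and R X A S
    assume "good_fragmentation M k r D R X A" and a: "0 < L" "1 \<le> R" "finite S"
      "S \<subseteq> potential_sticks k R" "S \<noteq> {}" "m * num_words k (Suc K) * R \<le> card S"
    then interpret good_fragmentation M k r D R X A by simp
    have "real m * real (num_words k (Suc K)) * real R \<le> card S"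
      unfolding of_nat_mult[symmetric] of_nat_le_iff by (rule a(6))
    then show "integral\<^sup>L M (\<lambda>\<omega>. cmod (\<Sum>v\<in>S. char_at t (stick_length k L X \<omega> v))) \<le> \<eta> * card S"
      using m0 by (intro char_sum_first_moment[OF a(1) \<rho>(1) _ a(3-5) _ _ a(2) \<eta> mK] \<rho>(3)) auto
  qed
qed

definition fraction_le :: "real \<Rightarrow> real \<Rightarrow> ('i \<Rightarrow> real) \<Rightarrow> 'i set \<Rightarrow> real" where
  "fraction_le B s len S = real (card {v \<in> S. significand B (len v) \<le> s}) / real (card S)"

lemma fraction_le_01: "finite S \<Longrightarrow> 0 \<le> fraction_le B s len S" "finite S \<Longrightarrow> fraction_le B s len S \<le> 1"
  by (auto simp: fraction_le_def divide_le_eq_1 card_gt_0_iff intro!: card_mono)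

text \<open>The frequencies \<open>F\<close> that Weyl's criterion needs for the given precision are finitely many, so one
  threshold serves all of them.\<close>

lemma fixed_sticks_benford:
  assumes k: "1 \<le> k" and good: "good_distribution (k - 1) D"
    and B: "1 < B" and s: "1 \<le> s" "s < B" and e: "0 < (e::real)"
  shows "\<exists>C0::nat. \<forall>(M :: 'a measure) r R X A L S.
    good_fragmentation M k r D R X A \<longrightarrow> 0 < L \<longrightarrow> 1 \<le> R \<longrightarrow> finite S \<longrightarrow> S \<subseteq> potential_sticks k R \<longrightarrow>
    S \<noteq> {} \<longrightarrow> C0 * R \<le> card S \<longrightarrow>
    integral\<^sup>L M (\<lambda>\<omega>. \<bar>fraction_le B s (stick_length k L X \<omega>) S - log B s\<bar>) \<le> e"
proof -
  define \<alpha> where "\<alpha> = log B s"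
  have \<alpha>: "0 \<le> \<alpha>" "\<alpha> \<le> 1" using B s by (auto simp: \<alpha>_def log_le_iff)
  obtain C F where CF: "0 \<le> C" "finite F" "0 \<notin> F"
    and weyl: "\<And>S y. finite (S :: stick set) \<Longrightarrow>
      \<bar>real (card {v \<in> S. frac (y v) \<le> \<alpha>}) - \<alpha> * card S\<bar>
         \<le> e / 2 * card S + C * (\<Sum>m\<in>F. cmod (\<Sum>v\<in>S. cis (2 * pi * of_int m * y v)))"
    using weyl_bound[OF \<alpha>, of "e / 2", where ?'i = stick] e by auto
  \<comment> \<open>chosen so that all \<open>card F\<close> exponential sums together cost at most
      \<open>e / 2\<close>; the summand \<open>1\<close> only keeps the denominator positive\<close>
  define \<eta> where "\<eta> = e / (2 * (C * card F + 1))"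
  have CF0: "0 \<le> C * card F" using CF by simp
  have \<eta>: "0 < \<eta>" unfolding \<eta>_def using e CF0 by (intro divide_pos_pos) auto
  have C\<eta>: "C * (card F * \<eta>) \<le> e / 2"
  proof -
    have "C * card F * \<eta> \<le> (C * card F + 1) * \<eta>" using \<eta> by (simp add: distrib_right)
    also have "\<dots> = e / 2" using CF0 by (simp add: \<eta>_def field_simps add_nonneg_eq_0_iff)
    finally show ?thesis by (simp add: mult.assoc)
  qed
  define tt where "tt m = 2 * pi * of_int m / ln B" for m :: int
  have tt: "tt m \<noteq> 0" if "m \<in> F" for m
    using that CF B by (auto simp: tt_def)
  have "\<forall>m\<in>F. \<exists>C0::nat. \<forall>(M :: 'a measure) r R X A L S.
    good_fragmentation M k r D R X A \<longrightarrow> 0 < L \<longrightarrow> 1 \<le> R \<longrightarrow> finite S \<longrightarrow> S \<subseteq> potential_sticks k R \<longrightarrow>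
    S \<noteq> {} \<longrightarrow> C0 * R \<le> card S \<longrightarrow>
    integral\<^sup>L M (\<lambda>\<omega>. cmod (\<Sum>v\<in>S. char_at (tt m) (stick_length k L X \<omega> v))) \<le> \<eta> * card S"
    using char_sum_uniformly_small[OF k good tt \<eta>] by blast
  from bchoice[OF this] obtain c0 where c0: "\<And>m (M :: 'a measure) r R X A L S. m \<in> F \<Longrightarrow>
    good_fragmentation M k r D R X A \<Longrightarrow> 0 < L \<Longrightarrow> 1 \<le> R \<Longrightarrow> finite S \<Longrightarrow> S \<subseteq> potential_sticks k R \<Longrightarrow>
    S \<noteq> {} \<Longrightarrow> c0 m * R \<le> card S \<Longrightarrow>
    integral\<^sup>L M (\<lambda>\<omega>. cmod (\<Sum>v\<in>S. char_at (tt m) (stick_length k L X \<omega> v))) \<le> \<eta> * card S"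
    by metis
  show ?thesis
  proof (intro exI[of _ "sum c0 F"] allI impI)
    fix M :: "'a measure" and r L :: real and R X A S
    assume gf: "good_fragmentation M k r D R X A" and L: "0 < L" and R: "1 \<le> R" and S: "finite S"
      "S \<subseteq> potential_sticks k R" "S \<noteq> {}" and card: "sum c0 F * R \<le> card S"
    interpret good_fragmentation M k r D R X A by (rule gf)
    define Z where "Z m \<omega> = cmod (\<Sum>v\<in>S. char_at (tt m) (stick_length k L X \<omega> v))" for m \<omega>
    define n where "n = real (card S)"
    have n: "0 < n" using S by (auto simp: n_def card_gt_0_iff)
    have [measurable]: "(\<lambda>\<omega>. stick_length k L X \<omega> v) \<in> borel_measurable M" if "v \<in> S" for v
      using that S by (intro stick_length_random_variable) auto
    have Zint: "integrable M (Z m)" for m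
    proof (rule integrable_const_bound[of _ n])
      show "Z m \<in> borel_measurable M" unfolding Z_def by measurable
      show "AE \<omega> in M. norm (Z m \<omega>) \<le> n"
        unfolding Z_def n_def by (auto intro!: order_trans[OF norm_sum])
    qed
    have EZ: "expectation (Z m) \<le> \<eta> * n" if "m \<in> F" for m
      unfolding Z_def n_def
    proof (rule c0[OF that gf L R S])
      have "c0 m \<le> sum c0 F" using that CF by (intro member_le_sum) auto
      then show "c0 m * R \<le> card S" using card by (meson le_trans mult_le_mono1)
    qed
    obtain lev where lev: "S \<subseteq> sticks_below k R lev"
      using finite_potential_subset_below[OF S(1,2)] .
    have "expectation (\<lambda>\<omega>. \<bar>fraction_le B s (stick_length k L X \<omega>) S - \<alpha>\<bar>)
      \<le> expectation (\<lambda>\<omega>. e / 2 + C / n * (\<Sum>m\<in>F. Z m \<omega>))"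
    proof (rule integral_mono_AE')
      show "integrable M (\<lambda>\<omega>. e / 2 + C / n * (\<Sum>m\<in>F. Z m \<omega>))"
        using Zint by auto
      show "AE \<omega> in M. \<bar>fraction_le B s (stick_length k L X \<omega>) S - \<alpha>\<bar> \<le> e / 2 + C / n * (\<Sum>m\<in>F. Z m \<omega>)"
        using AE_length_char[OF L, of lev 0]
      proof eventually_elim
        case (elim \<omega>)
        let ?len = "stick_length k L X \<omega>"
        have pos: "0 < ?len v" if "v \<in> S" for v
        proof -
          have "v \<in> sticks_below k R (Suc lev)" using that lev by (auto simp: sticks_below_def)
          then show ?thesis using elim by blast
        qed
        have Z_eq: "cmod (\<Sum>v\<in>S. cis (2 * pi * of_int m * log B (?len v))) = Z m \<omega>" for m
          by (simp add: Z_def char_at_def tt_def log_def)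
        have set_eq: "{v \<in> S. significand B (?len v) \<le> s} = {v \<in> S. frac (log B (?len v)) \<le> \<alpha>}"
          using pos significand_le_iff[OF B] s by (auto simp: \<alpha>_def)
        have "\<bar>fraction_le B s ?len S - \<alpha>\<bar> * n = \<bar>(fraction_le B s ?len S - \<alpha>) * n\<bar>"
          using n by (simp add: abs_mult)
        also have "\<dots> = \<bar>real (card {v \<in> S. frac (log B (?len v)) \<le> \<alpha>}) - \<alpha> * n\<bar>"
          using n by (simp add: fraction_le_def set_eq n_def left_diff_distrib)
        also have "\<dots> \<le> e / 2 * n + C * (\<Sum>m\<in>F. Z m \<omega>)"
          using weyl[OF S(1), of "\<lambda>v. log B (?len v)"] by (simp add: Z_eq n_def)
        also have "\<dots> = (e / 2 + C / n * (\<Sum>m\<in>F. Z m \<omega>)) * n"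
          using n by (simp add: field_simps)
        finally show ?case using n by (simp add: mult_le_cancel_right)
      qed
    qed (use e CF n in \<open>auto simp: Z_def intro!: add_nonneg_nonneg divide_nonneg_nonneg
        mult_nonneg_nonneg sum_nonneg\<close>)
    also have "\<dots> = e / 2 + C / n * (\<Sum>m\<in>F. expectation (Z m))"
      using Zint by (simp add: prob_space)
    also have "\<dots> \<le> e / 2 + C / n * (\<Sum>m\<in>F. \<eta> * n)"
      using CF n EZ by (intro add_left_mono mult_left_mono sum_mono) auto
    also have "\<dots> = e / 2 + C * (card F * \<eta>)" using n by simp
    also have "\<dots> \<le> e" using C\<eta> by simp
    finally show "expectation (\<lambda>\<omega>. \<bar>fraction_le B s (stick_length k L X \<omega>) S - log B s\<bar>) \<le> e"
      by (simp add: \<alpha>_def)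
  qed
qed

section \<open>Conditioning on the statuses\<close>

lemma stick_length_restrict:
  assumes "v \<in> potential_sticks k R"
  shows "stick_length k L (\<lambda>v x. x v) (\<lambda>v\<in>potential_sticks k R. X v \<omega>) v = stick_length k L X \<omega> v"
proof -
  have "stick_length k L (\<lambda>v x. x v) (\<lambda>v\<in>potential_sticks k R. X v \<omega>) (j, p) = stick_length k L X \<omega> (j, p)"
    if "(j, p) \<in> potential_sticks k R" for j p
    using that by (induction p) (auto simp: potential_sticks_Cons)
  then show ?thesis using assms by (cases v) auto
qed

lemma alive_restrict:
  assumes "v \<in> potential_sticks k R"
  shows "alive (\<lambda>v a. a v) (\<lambda>v\<in>potential_sticks k R. A v \<omega>) v = alive A \<omega> v"
proof -
  have "alive (\<lambda>v a. a v) (\<lambda>v\<in>potential_sticks k R. A v \<omega>) (j, p) = alive A \<omega> (j, p)"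
    if "(j, p) \<in> potential_sticks k R" for j p
    using that by (induction p) (auto simp: potential_sticks_Cons)
  then show ?thesis using assms by (cases v) auto
qed

lemma created_iff: "created A \<omega> v \<longleftrightarrow> snd v = [] \<or> alive A \<omega> (fst v, tl (snd v))"
  by (cases "(A, \<omega>, v)" rule: created.cases) auto

lemma potential_sticks_tl: "v \<in> potential_sticks k R \<Longrightarrow> (fst v, tl (snd v)) \<in> potential_sticks k R"
  using potential_sticks_drop[of "fst v" "snd v" k R 1] by (simp add: drop_Suc)

lemma resulting_sticks_restrict:
  "resulting_sticks k R (\<lambda>v a. a v) N (\<lambda>v\<in>potential_sticks k R. A v \<omega>) = resulting_sticks k R A N \<omega>"
  unfolding resulting_sticks_def created_iff
  by (intro Collect_cong conj_cong refl) (simp_all only: alive_restrict potential_sticks_tl)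

lemma alive_measurable:
  assumes A: "\<And>v. v \<in> potential_sticks k R \<Longrightarrow> A v \<in> M \<rightarrow>\<^sub>M PiM {..<k} (\<lambda>_. count_space UNIV)"
    and v: "v \<in> potential_sticks k R"
  shows "Measurable.pred M (\<lambda>\<omega>. alive A \<omega> v)"
proof -
  have "Measurable.pred M (\<lambda>\<omega>. alive A \<omega> (j, p))"
    if "(j, p) \<in> potential_sticks k R" for j p
    using that
  proof (induction p)
    case (Cons i p)
    then have i: "i < k" and p: "(j, p) \<in> potential_sticks k R"
      by (auto simp: potential_sticks_Cons)
    have [measurable]: "Measurable.pred M (\<lambda>\<omega>. A (j, p) \<omega> i)"
      using i by (intro measurable_compose[OF A[OF p]] measurable_component_singleton) simp
    have [measurable]: "Measurable.pred M (\<lambda>\<omega>. alive A \<omega> (j, p))" by (rule Cons.IH[OF p])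
    show ?case unfolding alive.simps by measurable
  qed simp
  then show ?thesis using v by (cases v) auto
qed

lemma resulting_sticks_subset: "resulting_sticks k R A N \<omega> \<subseteq> sticks_below k R (Suc N)"
  by (auto simp: resulting_sticks_def sticks_below_def)

lemma finite_resulting_sticks: "finite (resulting_sticks k R A N \<omega>)"
  by (rule finite_subset[OF resulting_sticks_subset finite_sticks_below])

text \<open>Only finitely many potential sticks can result after \<open>N\<close> levels, so the event is a finite
  combination of the events that given sticks are alive.\<close>

lemma resulting_sticks_measurable:
  assumes A: "\<And>v. v \<in> potential_sticks k R \<Longrightarrow> A v \<in> M \<rightarrow>\<^sub>M PiM {..<k} (\<lambda>_. count_space UNIV)"
  shows "Measurable.pred M (\<lambda>\<omega>. resulting_sticks k R A N \<omega> = S)"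
proof (cases "S \<subseteq> sticks_below k R (Suc N)")
  case True
  have eq: "resulting_sticks k R A N \<omega> = S \<longleftrightarrow>
    (\<forall>v\<in>sticks_below k R (Suc N). v \<in> S \<longleftrightarrow> v \<in> resulting_sticks k R A N \<omega>)" for \<omega>
    using True resulting_sticks_subset[of k R A N \<omega>] by blast
  have "Measurable.pred M (\<lambda>\<omega>. v \<in> resulting_sticks k R A N \<omega>)"
    if "v \<in> potential_sticks k R" for v
  proof -
    have [measurable]: "Measurable.pred M (\<lambda>\<omega>. alive A \<omega> v)"
      "Measurable.pred M (\<lambda>\<omega>. alive A \<omega> (fst v, tl (snd v)))"
      by (rule alive_measurable[OF A], assumption, rule that)
        (rule alive_measurable[OF A], assumption, rule potential_sticks_tl, rule that)
    show ?thesis unfolding resulting_sticks_def created_iff mem_Collect_eq by measurable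
  qed
  then have [measurable]: "Measurable.pred M (\<lambda>\<omega>. v \<in> resulting_sticks k R A N \<omega>)"
    if "v \<in> sticks_below k R (Suc N)" for v
    using that sticks_below_subset by blast
  show ?thesis unfolding eq
    using countable_finite[OF finite_sticks_below] by measurable
next
  case False
  then have "(\<lambda>\<omega>. resulting_sticks k R A N \<omega> = S) = (\<lambda>_. False)"
    using resulting_sticks_subset by (metis)
  then show ?thesis by simp
qed

context fragmentation
begin

lemma statuses_measurable:
  "v \<in> potential_sticks k R \<Longrightarrow> A v \<in> M \<rightarrow>\<^sub>M PiM {..<k} (\<lambda>_. count_space UNIV)"
  using statuses_indep by (auto simp: indep_vars_def)

abbreviation "all_cuts \<equiv> \<lambda>\<omega>. \<lambda>v\<in>potential_sticks k R. X v \<omega>"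
abbreviation "all_statuses \<equiv> \<lambda>\<omega>. \<lambda>v\<in>potential_sticks k R. A v \<omega>"

lemma all_cuts_measurable: "all_cuts \<in> M \<rightarrow>\<^sub>M PiM (potential_sticks k R) (\<lambda>_. D)"
  using cuts_indep by (intro measurable_restrict) (auto simp: indep_vars_def)

lemma all_statuses_measurable:
  "all_statuses \<in> M \<rightarrow>\<^sub>M PiM (potential_sticks k R) (\<lambda>_. PiM {..<k} (\<lambda>_. count_space UNIV))"
  by (intro measurable_restrict statuses_measurable)

text \<open>The two families have values of different types, but functions of them with values in one type
  are covered by \<open>indep_var\<close>. The preimages under such functions are among the preimages under the
  families themselves.\<close>

lemma indep_var_cuts_statuses:
  assumes f: "f \<in> borel_measurable (PiM (potential_sticks k R) (\<lambda>_. D))"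
    and g: "g \<in> borel_measurable (PiM (potential_sticks k R) (\<lambda>_. PiM {..<k} (\<lambda>_. count_space UNIV)))"
  shows "indep_var borel (\<lambda>\<omega>. f (all_cuts \<omega>)) borel (\<lambda>\<omega>. g (all_statuses \<omega>))"
  unfolding indep_var_eq
proof (intro conjI indep_set_sigma_sets)
  show "(\<lambda>\<omega>. f (all_cuts \<omega>)) \<in> borel_measurable M"
    by (rule measurable_compose[OF all_cuts_measurable f])
  show "(\<lambda>\<omega>. g (all_statuses \<omega>)) \<in> borel_measurable M"
    by (rule measurable_compose[OF all_statuses_measurable g])
  have preimage: "{(\<lambda>\<omega>. h (Y \<omega>)) -` E \<inter> space M |E. E \<in> sets borel} \<subseteq> {Y -` F \<inter> space M |F. F \<in> sets P}"
    if "Y \<in> M \<rightarrow>\<^sub>M P" "h \<in> borel_measurable P" for h :: "'y \<Rightarrow> 'z::topological_space" and Y P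
  proof clarify
    fix E :: "'z set" assume "E \<in> sets borel"
    then have "h -` E \<inter> space P \<in> sets P" by (rule measurable_sets[OF that(2)])
    moreover have "(\<lambda>\<omega>. h (Y \<omega>)) -` E \<inter> space M = Y -` (h -` E \<inter> space P) \<inter> space M"
      using measurable_space[OF that(1)] by auto
    ultimately show "\<exists>F. (\<lambda>\<omega>. h (Y \<omega>)) -` E \<inter> space M = Y -` F \<inter> space M \<and> F \<in> sets P"
      by blast
  qed
  show "indep_set {(\<lambda>\<omega>. f (all_cuts \<omega>)) -` E \<inter> space M |E. E \<in> sets borel}
      {(\<lambda>\<omega>. g (all_statuses \<omega>)) -` E \<inter> space M |E. E \<in> sets borel}"
    using cuts_statuses_indep unfolding indep_set_def
  proof (rule indep_sets_mono_sets)
    fix b :: bool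
    show "(case b of True \<Rightarrow> {(\<lambda>\<omega>. f (all_cuts \<omega>)) -` E \<inter> space M |E. E \<in> sets borel}
        | False \<Rightarrow> {(\<lambda>\<omega>. g (all_statuses \<omega>)) -` E \<inter> space M |E. E \<in> sets borel}) \<subseteq>
      (case b of True \<Rightarrow> {all_cuts -` E \<inter> space M | E. E \<in> sets (PiM (potential_sticks k R) (\<lambda>_. D))}
        | False \<Rightarrow> {all_statuses -` F \<inter> space M | F.
            F \<in> sets (PiM (potential_sticks k R) (\<lambda>_. PiM {..<k} (\<lambda>_. count_space UNIV)))})"
    proof (cases b)
      case True
      then show ?thesis using preimage[OF all_cuts_measurable f] by simp
    next
      case False
      then show ?thesis using preimage[OF all_statuses_measurable g] by simp
    qed
  qed
  have stable: "Int_stable {h -` E \<inter> space M |E. E \<in> sets borel}" for h :: "'a \<Rightarrow> 'z::topological_space"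
  proof (rule Int_stableI)
    fix a b assume "a \<in> {h -` E \<inter> space M |E. E \<in> sets borel}" "b \<in> {h -` E \<inter> space M |E. E \<in> sets borel}"
    then obtain E F where "E \<in> sets borel" "F \<in> sets borel" "a = h -` E \<inter> space M" "b = h -` F \<inter> space M"
      by blast
    then have "a \<inter> b = h -` (E \<inter> F) \<inter> space M" "E \<inter> F \<in> sets borel" by auto
    then show "a \<inter> b \<in> {h -` E \<inter> space M |E. E \<in> sets borel}" by blast
  qed
  show "Int_stable {(\<lambda>\<omega>. f (all_cuts \<omega>)) -` E \<inter> space M |E. E \<in> sets borel}"
    "Int_stable {(\<lambda>\<omega>. g (all_statuses \<omega>)) -` E \<inter> space M |E. E \<in> sets borel}"
    by (rule stable)+
qed

text \<open>The law of total expectation over the finitely many possible sets \<open>S\<close> of resulting sticks: the event that \<open>S\<close>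
  results is determined by the statuses, and \<open>h S\<close> is a function of the cut points.\<close>

lemma expectation_resulting_sticks:
  fixes h :: "stick set \<Rightarrow> (stick \<Rightarrow> nat \<Rightarrow> real) \<Rightarrow> real"
  assumes h: "\<And>S. S \<subseteq> sticks_below k R (Suc N) \<Longrightarrow>
      h S \<in> borel_measurable (PiM (potential_sticks k R) (\<lambda>_. D))"
    and h0: "\<And>S x. finite S \<Longrightarrow> 0 \<le> h S x" and h1: "\<And>S x. finite S \<Longrightarrow> h S x \<le> 1"
  shows "integrable M (\<lambda>\<omega>. h (resulting_sticks k R A N \<omega>) (all_cuts \<omega>))"
    and "expectation (\<lambda>\<omega>. h (resulting_sticks k R A N \<omega>) (all_cuts \<omega>)) =
      (\<Sum>S\<in>Pow (sticks_below k R (Suc N)).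
        expectation (\<lambda>\<omega>. h S (all_cuts \<omega>)) * prob {\<omega> \<in> space M. resulting_sticks k R A N \<omega> = S})"
proof -
  let ?V = "sticks_below k R (Suc N)" and ?Res = "resulting_sticks k R A N"
  define g :: "stick set \<Rightarrow> (stick \<Rightarrow> nat \<Rightarrow> bool) \<Rightarrow> real" where
    "g S a = of_bool (resulting_sticks k R (\<lambda>v a. a v) N a = S)" for S a
  have fin: "finite (Pow ?V)" by (simp add: finite_sticks_below)
  have Res_in: "?Res \<omega> \<in> Pow ?V" for \<omega> using resulting_sticks_subset by (rule PowI)
  have finS: "finite S" if "S \<in> Pow ?V" for S
    using that finite_sticks_below by (auto intro: finite_subset)
  have g_meas: "g S \<in> borel_measurable (PiM (potential_sticks k R) (\<lambda>_. PiM {..<k} (\<lambda>_. count_space UNIV)))" for S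
  proof -
    have [measurable]: "Measurable.pred (PiM (potential_sticks k R) (\<lambda>_. PiM {..<k} (\<lambda>_. count_space UNIV)))
        (\<lambda>a. resulting_sticks k R (\<lambda>v a. a v) N a = S)"
      by (rule resulting_sticks_measurable) (rule measurable_component_singleton)
    show ?thesis unfolding g_def by measurable
  qed
  have g_eq: "g S (all_statuses \<omega>) = of_bool (?Res \<omega> = S)" for S \<omega>
    by (simp add: g_def resulting_sticks_restrict)
  have split: "h (?Res \<omega>) (all_cuts \<omega>) = (\<Sum>S\<in>Pow ?V. h S (all_cuts \<omega>) * g S (all_statuses \<omega>))" for \<omega>
  proof -
    have "(\<Sum>S\<in>Pow ?V. h S (all_cuts \<omega>) * g S (all_statuses \<omega>)) =
        (\<Sum>S\<in>Pow ?V. if S = ?Res \<omega> then h S (all_cuts \<omega>) else 0)"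
      unfolding g_eq by (intro sum.cong) auto
    also have "\<dots> = h (?Res \<omega>) (all_cuts \<omega>)"
      using fin Res_in by (subst sum.delta) auto
    finally show ?thesis by simp
  qed
  have h_int: "integrable M (\<lambda>\<omega>. h S (all_cuts \<omega>))" if "S \<in> Pow ?V" for S
  proof (rule integrable_const_bound[of _ 1])
    show "(\<lambda>\<omega>. h S (all_cuts \<omega>)) \<in> borel_measurable M"
      using that by (intro measurable_compose[OF all_cuts_measurable] h) auto
  qed (use h0[OF finS[OF that]] h1[OF finS[OF that]] in auto)
  have g_int: "integrable M (\<lambda>\<omega>. g S (all_statuses \<omega>))" for S
    by (rule integrable_const_bound[of _ 1, OF _ measurable_compose[OF all_statuses_measurable g_meas]])
       (auto simp: g_def)
  have indep: "indep_var borel (\<lambda>\<omega>. h S (all_cuts \<omega>)) borel (\<lambda>\<omega>. g S (all_statuses \<omega>))"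
    if "S \<in> Pow ?V" for S
    using that by (intro indep_var_cuts_statuses h g_meas) auto
  show "integrable M (\<lambda>\<omega>. h (?Res \<omega>) (all_cuts \<omega>))"
    unfolding split by (intro Bochner_Integration.integrable_sum indep_var_integrable indep h_int g_int)
  have "expectation (\<lambda>\<omega>. h (?Res \<omega>) (all_cuts \<omega>)) =
     (\<Sum>S\<in>Pow ?V. expectation (\<lambda>\<omega>. h S (all_cuts \<omega>)) * expectation (\<lambda>\<omega>. g S (all_statuses \<omega>)))"
    unfolding split
    by (subst Bochner_Integration.integral_sum)
       (auto intro!: sum.cong indep_var_integrable indep_var_lebesgue_integral indep h_int g_int)
  also have "\<dots> = (\<Sum>S\<in>Pow ?V. expectation (\<lambda>\<omega>. h S (all_cuts \<omega>)) * prob {\<omega> \<in> space M. ?Res \<omega> = S})"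
  proof (intro sum.cong refl arg_cong2[where f = "(*)"])
    fix S
    have "expectation (\<lambda>\<omega>. g S (all_statuses \<omega>)) = expectation (indicator {\<omega> \<in> space M. ?Res \<omega> = S})"
      by (intro Bochner_Integration.integral_cong) (auto simp: g_eq indicator_def)
    also have "\<dots> = prob {\<omega> \<in> space M. ?Res \<omega> = S}"
      by (simp add: Int_absorb2)
    finally show "expectation (\<lambda>\<omega>. g S (all_statuses \<omega>)) = prob {\<omega> \<in> space M. ?Res \<omega> = S}" .
  qed
  finally show "expectation (\<lambda>\<omega>. h (?Res \<omega>) (all_cuts \<omega>)) =
      (\<Sum>S\<in>Pow ?V. expectation (\<lambda>\<omega>. h S (all_cuts \<omega>)) * prob {\<omega> \<in> space M. ?Res \<omega> = S})" .
qed

lemma expectation_resulting_sticks_le: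
  fixes h :: "stick set \<Rightarrow> (stick \<Rightarrow> nat \<Rightarrow> real) \<Rightarrow> real"
  assumes h: "\<And>S. S \<subseteq> sticks_below k R (Suc N) \<Longrightarrow>
      h S \<in> borel_measurable (PiM (potential_sticks k R) (\<lambda>_. D))"
    and h0: "\<And>S x. finite S \<Longrightarrow> 0 \<le> h S x" and h1: "\<And>S x. finite S \<Longrightarrow> h S x \<le> 1"
    and large: "\<And>S. S \<subseteq> sticks_below k R (Suc N) \<Longrightarrow> c \<le> card S \<Longrightarrow>
      expectation (\<lambda>\<omega>. h S (all_cuts \<omega>)) \<le> e"
    and e: "0 \<le> e"
  shows "expectation (\<lambda>\<omega>. h (resulting_sticks k R A N \<omega>) (all_cuts \<omega>))
    \<le> e + prob {\<omega> \<in> space M. card (resulting_sticks k R A N \<omega>) < c}"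
proof -
  let ?V = "sticks_below k R (Suc N)" and ?Res = "resulting_sticks k R A N"
  define q where "q S = prob {\<omega> \<in> space M. ?Res \<omega> = S}" for S
  have fin: "finite (Pow ?V)" by (simp add: finite_sticks_below)
  have Res_in: "?Res \<omega> \<in> Pow ?V" for \<omega> using resulting_sticks_subset by (rule PowI)
  have Res_meas [measurable]: "Measurable.pred M (\<lambda>\<omega>. ?Res \<omega> = S)" for S
    by (rule resulting_sticks_measurable) (rule statuses_measurable)
  have prob_sum: "(\<Sum>S | S \<in> Pow ?V \<and> P S. q S) = prob {\<omega> \<in> space M. P (?Res \<omega>)}" for P
  proof -
    have "(\<Sum>S | S \<in> Pow ?V \<and> P S. q S) = prob (\<Union>S\<in>{S. S \<in> Pow ?V \<and> P S}. {\<omega> \<in> space M. ?Res \<omega> = S})"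
      unfolding q_def
      by (rule finite_measure_finite_Union[symmetric])
        (use fin in \<open>auto simp: disjoint_family_on_def intro!: finite_subset[OF _ fin]\<close>)
    also have "(\<Union>S\<in>{S. S \<in> Pow ?V \<and> P S}. {\<omega> \<in> space M. ?Res \<omega> = S}) = {\<omega> \<in> space M. P (?Res \<omega>)}"
      using Res_in by auto
    finally show ?thesis .
  qed
  have le1: "expectation (\<lambda>\<omega>. h S (all_cuts \<omega>)) \<le> 1" if "S \<in> Pow ?V" for S
  proof -
    have "finite S" using that finite_sticks_below by (auto intro: finite_subset)
    then have "expectation (\<lambda>\<omega>. h S (all_cuts \<omega>)) \<le> expectation (\<lambda>_. 1)"
      by (intro integral_mono_AE') (auto simp: h0 h1)
    then show ?thesis by (simp add: prob_space)
  qed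
  have "expectation (\<lambda>\<omega>. h (?Res \<omega>) (all_cuts \<omega>)) = (\<Sum>S\<in>Pow ?V. expectation (\<lambda>\<omega>. h S (all_cuts \<omega>)) * q S)"
    unfolding q_def by (rule expectation_resulting_sticks(2)[OF h h0 h1])
  also have "\<dots> \<le> (\<Sum>S\<in>Pow ?V. e * q S + (if card S < c then q S else 0))"
  proof (rule sum_mono)
    fix S assume S: "S \<in> Pow ?V"
    have q0: "0 \<le> q S" by (simp add: q_def)
    show "expectation (\<lambda>\<omega>. h S (all_cuts \<omega>)) * q S \<le> e * q S + (if card S < c then q S else 0)"
    proof (cases "card S < c")
      case True
      then show ?thesis
        using mult_right_mono[OF le1[OF S] q0] mult_nonneg_nonneg[OF e q0] by simp
    next
      case False
      then show ?thesis using mult_right_mono[OF large[of S] q0] S by simp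
    qed
  qed
  also have "\<dots> = e * (\<Sum>S | S \<in> Pow ?V \<and> True. q S) + (\<Sum>S | S \<in> Pow ?V \<and> card S < c. q S)"
    using sum.inter_filter[OF fin, of q "\<lambda>S. card S < c"]
    by (simp add: sum.distrib sum_distrib_left del: Pow_iff)
  also have "\<dots> = e + prob {\<omega> \<in> space M. card (?Res \<omega>) < c}"
    unfolding prob_sum by (simp add: prob_space)
  finally show ?thesis .
qed

end

section \<open>The number of sticks per initial stick\<close>

text \<open>Going from level \<open>N\<close> to level \<open>N + 1\<close> replaces each living stick of level \<open>N\<close> by its \<open>k\<close>
  children, which adds at least one stick for each of them as \<open>k \<ge> 2\<close>.\<close>

lemma card_resulting_sticks_ge:
  assumes k: "2 \<le> k"
  shows "card {v \<in> sticks_below k R N. alive A \<omega> v} \<le> card (resulting_sticks k R A N \<omega>)"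
proof (induction N)
  case 0
  then show ?case by (simp add: sticks_below_def)
next
  case (Suc N)
  define Lev where "Lev = {v \<in> potential_sticks k R. length (snd v) = N \<and> alive A \<omega> v}"
  define Ch where "Ch = (\<lambda>(v, i). (fst v, i # snd v)) ` (Lev \<times> {..<k})"
  let ?Res = "resulting_sticks k R A"
  have fin: "finite Lev"
    by (rule finite_subset[OF _ finite_sticks_below[of k R "Suc N"]]) (auto simp: Lev_def sticks_below_def)
  have created: "created A \<omega> v" if "alive A \<omega> v" for v
    using that by (cases "(A, \<omega>, v)" rule: alive.cases) auto
  have "Lev \<subseteq> ?Res N \<omega>" by (auto simp: Lev_def resulting_sticks_def created)
  have "?Res (Suc N) \<omega> = (?Res N \<omega> - Lev) \<union> Ch"
  proof (intro equalityI subsetI)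
    fix v assume v: "v \<in> ?Res (Suc N) \<omega>"
    show "v \<in> (?Res N \<omega> - Lev) \<union> Ch"
    proof (cases "length (snd v) \<le> N")
      case True
      then show ?thesis using v by (auto simp: resulting_sticks_def Lev_def)
    next
      case False
      then have "length (snd v) = Suc N" using v by (auto simp: resulting_sticks_def)
      then obtain j i p where "v = (j, i # p)" "length p = N"
        by (cases v) (auto simp: length_Suc_conv)
      then have "v = (\<lambda>(v, i). (fst v, i # snd v)) ((j, p), i)" "((j, p), i) \<in> Lev \<times> {..<k}"
        using v by (auto simp: resulting_sticks_def Lev_def potential_sticks_Cons)
      then show ?thesis unfolding Ch_def by blast
    qed
  next
    fix v assume "v \<in> (?Res N \<omega> - Lev) \<union> Ch"
    then show "v \<in> ?Res (Suc N) \<omega>"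
      by (auto simp: resulting_sticks_def Lev_def Ch_def potential_sticks_Cons)
  qed
  moreover have "(?Res N \<omega> - Lev) \<inter> Ch = {}"
    by (auto simp: resulting_sticks_def Lev_def Ch_def)
  moreover have "card Ch = card Lev * k"
    unfolding Ch_def by (subst card_image) (auto simp: inj_on_def card_cartesian_product)
  moreover have "finite Ch" unfolding Ch_def using fin by auto
  ultimately have "card (?Res (Suc N) \<omega>) = (card (?Res N \<omega>) - card Lev) + card Lev * k"
    using fin \<open>Lev \<subseteq> ?Res N \<omega>\<close> finite_resulting_sticks[of k R A N \<omega>]
    by (simp add: card_Un_disjoint card_Diff_subset)
  moreover have "card Lev \<le> card (?Res N \<omega>)"
    by (intro card_mono finite_resulting_sticks \<open>Lev \<subseteq> ?Res N \<omega>\<close>)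
  moreover have "card Lev * 2 \<le> card Lev * k" using k by simp
  ultimately have "card (?Res N \<omega>) + card Lev \<le> card (?Res (Suc N) \<omega>)" by linarith
  moreover have "{v \<in> sticks_below k R (Suc N). alive A \<omega> v} = {v \<in> sticks_below k R N. alive A \<omega> v} \<union> Lev"
    by (auto simp: sticks_below_def Lev_def)
  then have "card {v \<in> sticks_below k R (Suc N). alive A \<omega> v} \<le> card {v \<in> sticks_below k R N. alive A \<omega> v} + card Lev"
    using card_Un_le by metis
  ultimately show ?case using Suc.IH by linarith
qed

context fragmentation
begin

abbreviation alive_var :: "stick \<Rightarrow> 'a \<Rightarrow> real" where
  "alive_var v \<omega> \<equiv> of_bool (alive A \<omega> v)"

abbreviation status_factor :: "stick \<Rightarrow> stick \<Rightarrow> (nat \<Rightarrow> bool) \<Rightarrow> real" where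
  "status_factor \<equiv> path_factor (\<lambda>i a. of_bool (a i))"

lemma alive_var_measurable [measurable]:
  "v \<in> potential_sticks k R \<Longrightarrow> alive_var v \<in> borel_measurable M"
  using alive_measurable[OF statuses_measurable, where v = v] by measurable

text \<open>The statuses of siblings may depend on each other; only the independence between
  different broken sticks enters, since a path visits each broken stick once.\<close>

lemma status_factor_expectation:
  assumes v: "v \<in> potential_sticks k R" and w: "w \<in> potential_sticks k R"
    and U: "finite U" "U \<subseteq> potential_sticks k R"
  shows "expectation (\<lambda>\<omega>. \<Prod>u\<in>U. status_factor v u (A u \<omega>) * status_factor w u (A u \<omega>)) =
    (\<Prod>u\<in>U. expectation (\<lambda>\<omega>. status_factor v u (A u \<omega>) * status_factor w u (A u \<omega>)))"
proof (rule expectation_prod_path_factors(1)[OF statuses_indep _ _ _ _ U v w])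
  fix i assume "i < k"
  then have [measurable]: "Measurable.pred (PiM {..<k} (\<lambda>_. count_space UNIV)) (\<lambda>a. a i)"
    by (intro measurable_component_singleton) simp
  then show "(\<lambda>a. of_bool (a i) :: real) \<in> borel_measurable (PiM {..<k} (\<lambda>_. count_space UNIV))"
    by measurable
  then show "(\<lambda>a. of_bool (a i) :: real) \<in> borel_measurable (PiM {..<k} (\<lambda>_. count_space UNIV))" .
qed auto

lemma alive_pair_expectation:
  assumes "v \<in> sticks_below k R (Suc n)" "w \<in> sticks_below k R (Suc n)"
  shows "expectation (\<lambda>\<omega>. alive_var v \<omega> * alive_var w \<omega>) =
    (\<Prod>u\<in>sticks_below k R n. expectation (\<lambda>\<omega>. status_factor v u (A u \<omega>) * status_factor w u (A u \<omega>)))"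
  unfolding alive_eq_prod[OF assms(1)] alive_eq_prod[OF assms(2)] prod.distrib[symmetric]
  using assms sticks_below_subset[of k R "Suc n"] sticks_below_subset[of k R n]
  by (intro status_factor_expectation finite_sticks_below) auto

lemma alive_expectation_prod:
  assumes v: "v \<in> sticks_below k R (Suc n)"
  shows "expectation (alive_var v) =
    (\<Prod>u\<in>sticks_below k R n. expectation (\<lambda>\<omega>. status_factor v u (A u \<omega>)))"
proof -
  \<comment> \<open>an initial stick is always alive and has only trivial factors, so the formula for pairs specializes
      to one stick\<close>
  have "(fst v, []) \<in> sticks_below k R (Suc n)"
    using v by (auto simp: sticks_below_def potential_sticks_def)
  from alive_pair_expectation[OF v this] show ?thesis by simp
qed

lemma alive_expectation:
  assumes "(j, p) \<in> potential_sticks k R"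
  shows "expectation (alive_var (j, p)) = r ^ length p"
  using assms
proof (induction p)
  case Nil
  then show ?case by (simp add: prob_space)
next
  case (Cons i p)
  define U where "U = sticks_below k R (Suc (length p))"
  have p: "(j, p) \<in> potential_sticks k R" and i: "i < k"
    using Cons.prems by (auto simp: potential_sticks_Cons)
  have self: "status_factor (j, p) (j, p) a = 1" for a
  proof (rule path_factor_eq_1)
    fix l assume "l < length p"
    then have "length (drop (Suc l) p) \<noteq> length p" by simp
    then show "(j, p) \<noteq> (j, drop (Suc l) p)" by (metis prod.inject)
  qed
  have pU: "(j, p) \<in> U" "(j, p) \<in> sticks_below k R (Suc (Suc (length p)))"
    "(j, i # p) \<in> sticks_below k R (Suc (Suc (length p)))"
    using p Cons.prems by (auto simp: U_def sticks_below_def)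
  have fin: "finite U" by (simp add: U_def finite_sticks_below)
  have child: "expectation (\<lambda>\<omega>. of_bool (A (j, p) \<omega> i)) = r"
  proof -
    have "expectation (\<lambda>\<omega>. of_bool (A (j, p) \<omega> i)) = expectation (indicator {\<omega> \<in> space M. A (j, p) \<omega> i})"
      by (intro Bochner_Integration.integral_cong) (auto simp: indicator_def)
    also have "\<dots> = prob {\<omega> \<in> space M. A (j, p) \<omega> i}" by (simp add: Int_absorb2)
    finally show ?thesis using alive_prob[OF p i] by simp
  qed
  have "expectation (alive_var (j, i # p)) = (\<Prod>u\<in>U. expectation (\<lambda>\<omega>. status_factor (j, i # p) u (A u \<omega>)))"
    unfolding U_def by (rule alive_expectation_prod[OF pU(3)])
  also have "\<dots> = (\<Prod>u\<in>U. expectation (\<lambda>\<omega>. status_factor (j, p) u (A u \<omega>)) * (if u = (j, p) then r else 1))"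
    by (intro prod.cong) (auto simp: self child prob_space)
  also have "\<dots> = expectation (alive_var (j, p)) * r"
    using fin pU(1) unfolding U_def alive_expectation_prod[OF pU(2)] by (simp add: prod.distrib)
  finally show ?case using Cons.IH[OF p] by simp
qed

text \<open>Sticks from different initial sticks have no ancestor in common, so at each broken stick at
  least one of the two factors is trivial.\<close>

lemma alive_pair_independent:
  assumes v: "v \<in> potential_sticks k R" and w: "w \<in> potential_sticks k R" and ne: "fst v \<noteq> fst w"
  shows "expectation (\<lambda>\<omega>. alive_var v \<omega> * alive_var w \<omega>) = expectation (alive_var v) * expectation (alive_var w)"
proof -
  define n where "n = max (length (snd v)) (length (snd w))"
  have mem: "v \<in> sticks_below k R (Suc n)" "w \<in> sticks_below k R (Suc n)"
    using v w by (auto simp: n_def sticks_below_def)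
  have other: "status_factor x u a = 1" if "fst u \<noteq> fst x" for x u a
    using that by (cases x) (auto intro!: path_factor_eq_1)
  have "expectation (\<lambda>\<omega>. status_factor v u (A u \<omega>) * status_factor w u (A u \<omega>)) =
    expectation (\<lambda>\<omega>. status_factor v u (A u \<omega>)) * expectation (\<lambda>\<omega>. status_factor w u (A u \<omega>))" for u
    using ne other[of u v] other[of u w] by (cases "fst u = fst v") (simp_all add: prob_space)
  then show ?thesis
    unfolding alive_pair_expectation[OF mem] alive_expectation_prod[OF mem(1)] alive_expectation_prod[OF mem(2)]
    by (simp add: prod.distrib)
qed

definition alive_below :: "nat \<Rightarrow> 'a \<Rightarrow> real" where
  "alive_below n \<omega> = (\<Sum>v\<in>sticks_below k R n. alive_var v \<omega>)"

lemma alive_below_eq_card: "alive_below n \<omega> = card {v \<in> sticks_below k R n. alive A \<omega> v}"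
  using finite_sticks_below by (simp add: alive_below_def of_bool_def sum.If_cases Int_def)

lemma alive_below_measurable: "alive_below n \<in> borel_measurable M"
  unfolding alive_below_def
  using sticks_below_subset by (intro borel_measurable_sum alive_var_measurable) blast

text \<open>A level \<open>l\<close> has \<open>R * k ^ l\<close> potential sticks, each alive with probability \<open>r ^ l = 1 / k ^ l\<close>.\<close>

lemma alive_below_expectation:
  assumes r: "r * k = 1"
  shows "expectation (alive_below n) = real R * n"
proof -
  have int: "integrable M (alive_var v)" if "v \<in> sticks_below k R n" for v
    using that sticks_below_subset by (intro integrable_const_bound[of _ 1] alive_var_measurable) auto
  have words: "(\<Sum>p | p \<in> lists {..<k} \<and> length p < n. r ^ length p) = real n" for n
  proof (induction n)
    case (Suc n)
    have eq: "{p. p \<in> lists {..<k} \<and> length p < Suc n} =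
        {p. p \<in> lists {..<k} \<and> length p < n} \<union> {p. set p \<subseteq> {..<k} \<and> length p = n}"
      by (auto simp: less_Suc_eq)
    have fin: "finite {p. set p \<subseteq> {..<k} \<and> length p = n}" by (rule finite_lists_length_eq) simp
    have "(\<Sum>p | p \<in> lists {..<k} \<and> length p < Suc n. r ^ length p) =
      real n + (\<Sum>p | set p \<subseteq> {..<k} \<and> length p = n. r ^ length p)"
      unfolding eq using fin finite_words[of k n] Suc.IH by (subst sum.union_disjoint) auto
    also have "(\<Sum>p | set p \<subseteq> {..<k} \<and> length p = n. r ^ length p) = (\<Sum>p | set p \<subseteq> {..<k} \<and> length p = n. r ^ n)"
      by (intro sum.cong) auto
    also have "\<dots> = (r * k) ^ n"
      by (simp add: card_lists_length_eq power_mult_distrib)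
    finally show ?case using r by simp
  qed simp
  have "expectation (alive_below n) = (\<Sum>v\<in>sticks_below k R n. expectation (alive_var v))"
    unfolding alive_below_def by (rule Bochner_Integration.integral_sum[OF int])
  also have "\<dots> = (\<Sum>(j, p)\<in>{..<R} \<times> {p \<in> lists {..<k}. length p < n}. r ^ length p)"
    unfolding sticks_below_altdef
    by (intro sum.cong) (auto simp: potential_sticks_def intro!: alive_expectation)
  also have "\<dots> = real R * n"
    using words[of n] by (simp add: sum.cartesian_product[symmetric])
  finally show ?thesis .
qed

text \<open>Only pairs of sticks from the same initial stick are correlated, and there are
  \<open>R * (num_words k n)\<^sup>2\<close> of these. Being linear in \<open>R\<close> is what matters.\<close>

lemma alive_below_variance: "variance (alive_below n) \<le> real R * (real (num_words k n))\<^sup>2"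
proof -
  define U where "U = sticks_below k R n"
  define b where "b v \<omega> = alive_var v \<omega> - expectation (alive_var v)" for v \<omega>
  have UP: "v \<in> potential_sticks k R" if "v \<in> U" for v
    using that sticks_below_subset by (auto simp: U_def)
  have int: "integrable M (alive_var v)" if "v \<in> U" for v
    using UP[OF that] by (intro integrable_const_bound[of _ 1] alive_var_measurable) auto
  have b_bd: "\<bar>b v \<omega>\<bar> \<le> 1" if "v \<in> U" for v \<omega>
  proof -
    have "expectation (alive_var v) \<le> expectation (\<lambda>_. 1)"
      by (intro integral_mono int that) auto
    moreover have "0 \<le> expectation (alive_var v)" by (rule Bochner_Integration.integral_nonneg) simp
    ultimately show ?thesis by (auto simp: b_def prob_space of_bool_def)
  qed
  have b_meas: "b v \<in> borel_measurable M" if "v \<in> U" for v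
    unfolding b_def using alive_var_measurable[OF UP[OF that]] by measurable
  have bb_int: "integrable M (\<lambda>\<omega>. b v \<omega> * b w \<omega>)" if "v \<in> U" "w \<in> U" for v w
    using b_bd[OF that(1)] b_bd[OF that(2)] b_meas[OF that(1)] b_meas[OF that(2)]
    by (intro integrable_const_bound[of _ 1] borel_measurable_times)
      (auto simp: abs_mult intro!: mult_le_one)
  have cov: "expectation (\<lambda>\<omega>. b v \<omega> * b w \<omega>) \<le> (if fst v = fst w then 1 else 0)"
    if v: "v \<in> U" and w: "w \<in> U" for v w
  proof (cases "fst v = fst w")
    case True
    have "expectation (\<lambda>\<omega>. b v \<omega> * b w \<omega>) \<le> expectation (\<lambda>_. 1)"
    proof (intro integral_mono bb_int v w)
      fix \<omega>
      have "b v \<omega> * b w \<omega> \<le> \<bar>b v \<omega>\<bar> * \<bar>b w \<omega>\<bar>" by (simp add: abs_mult[symmetric])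
      also have "\<dots> \<le> 1" using b_bd[OF v] b_bd[OF w] by (intro mult_le_one) auto
      finally show "b v \<omega> * b w \<omega> \<le> 1" .
    qed auto
    then show ?thesis using True by (simp add: prob_space)
  next
    case False
    have i2: "integrable M (\<lambda>\<omega>. alive_var v \<omega> * alive_var w \<omega>)"
      using alive_var_measurable[OF UP[OF v]] alive_var_measurable[OF UP[OF w]]
      by (intro integrable_const_bound[of _ 1] borel_measurable_times) auto
    define ev where "ev = expectation (alive_var v)"
    define ew where "ew = expectation (alive_var w)"
    have "expectation (\<lambda>\<omega>. b v \<omega> * b w \<omega>) =
      expectation (\<lambda>\<omega>. alive_var v \<omega> * alive_var w \<omega> - ew * alive_var v \<omega> - ev * alive_var w \<omega> + ev * ew)"
      by (intro Bochner_Integration.integral_cong) (simp_all add: b_def algebra_simps ev_def ew_def)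
    also have "\<dots> = expectation (\<lambda>\<omega>. alive_var v \<omega> * alive_var w \<omega>) - ew * ev - ev * ew + ev * ew"
      using i2 int[OF v] int[OF w] by (simp add: prob_space ev_def ew_def)
    also have "\<dots> = 0"
      using alive_pair_independent[OF UP[OF v] UP[OF w] False] by (simp add: ev_def ew_def)
    finally show ?thesis using False by simp
  qed
  have "expectation (alive_below n) = (\<Sum>v\<in>U. expectation (alive_var v))"
    unfolding alive_below_def U_def[symmetric] by (rule Bochner_Integration.integral_sum[OF int])
  then have "(alive_below n \<omega> - expectation (alive_below n))\<^sup>2 = (\<Sum>v\<in>U. \<Sum>w\<in>U. b v \<omega> * b w \<omega>)" for \<omega>
    by (simp add: alive_below_def U_def[symmetric] b_def sum_subtractf power2_eq_square
        flip: sum_product)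
  then have "variance (alive_below n) = (\<Sum>v\<in>U. \<Sum>w\<in>U. expectation (\<lambda>\<omega>. b v \<omega> * b w \<omega>))"
    using bb_int by (simp add: Bochner_Integration.integral_sum)
  also have "\<dots> \<le> (\<Sum>v\<in>U. \<Sum>w\<in>U. if fst v = fst w then 1 else 0)"
    by (intro sum_mono cov)
  also have "\<dots> = (\<Sum>(j, p)\<in>{..<R} \<times> {p \<in> lists {..<k}. length p < n}.
      \<Sum>(j', q)\<in>{..<R} \<times> {p \<in> lists {..<k}. length p < n}. if j = j' then 1 else 0)"
    unfolding U_def sticks_below_altdef by (simp add: case_prod_unfold)
  also have "\<dots> = real R * (real (num_words k n))\<^sup>2"
    by (simp add: sum.cartesian_product[symmetric] num_words_def power2_eq_square sum_distrib_left[symmetric])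
  finally show ?thesis .
qed

text \<open>The number of living sticks of level less than \<open>n\<close> has mean \<open>n R \<ge> 2 c R\<close>, so fewer than \<open>c R\<close> of them is a deviation by
  half the mean.\<close>

lemma few_resulting_sticks_prob:
  assumes k: "2 \<le> k" and r: "r * k = 1" and R: "1 \<le> R" and n: "1 \<le> n" "n \<le> N" and c: "2 * c \<le> n"
  shows "prob {\<omega> \<in> space M. card (resulting_sticks k R A N \<omega>) < c * R}
    \<le> 4 * (real (num_words k n))\<^sup>2 / real R"
proof -
  define \<mu> where "\<mu> = real R * n"
  have \<mu>: "0 < \<mu>" using R n by (simp add: \<mu>_def)
  have E: "expectation (alive_below n) = \<mu>" unfolding \<mu>_def by (rule alive_below_expectation[OF r])
  have sub: "{\<omega> \<in> space M. card (resulting_sticks k R A N \<omega>) < c * R} \<subseteq>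
    {\<omega> \<in> space M. \<mu> / 2 \<le> \<bar>alive_below n \<omega> - expectation (alive_below n)\<bar>}"
  proof safe
    fix \<omega> assume less: "card (resulting_sticks k R A N \<omega>) < c * R"
    have "card {v \<in> sticks_below k R n. alive A \<omega> v} \<le> card {v \<in> sticks_below k R N. alive A \<omega> v}"
    proof (rule card_mono)
      show "finite {v \<in> sticks_below k R N. alive A \<omega> v}" using finite_sticks_below[of k R N] by simp
      show "{v \<in> sticks_below k R n. alive A \<omega> v} \<subseteq> {v \<in> sticks_below k R N. alive A \<omega> v}"
        using n by (auto simp: sticks_below_def)
    qed
    also have "\<dots> \<le> card (resulting_sticks k R A N \<omega>)" by (rule card_resulting_sticks_ge[OF k])
    finally have "card {v \<in> sticks_below k R n. alive A \<omega> v} < c * R" using less by simp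
    then have "alive_below n \<omega> < real c * real R"
      unfolding alive_below_eq_card of_nat_mult[symmetric] of_nat_less_iff .
    also have "real c * real R \<le> \<mu> / 2"
      using mult_right_mono[of "2 * real c" "real n" "real R"] c by (simp add: \<mu>_def mult_ac)
    finally show "\<mu> / 2 \<le> \<bar>alive_below n \<omega> - expectation (alive_below n)\<bar>"
      unfolding E by linarith
  qed
  have [measurable]: "alive_below n \<in> borel_measurable M" by (rule alive_below_measurable)
  have bd: "\<bar>alive_below n \<omega>\<bar> \<le> real (card (sticks_below k R n))" for \<omega>
    unfolding alive_below_eq_card using finite_sticks_below by (auto intro!: card_mono)
  have sq_int: "integrable M (\<lambda>\<omega>. (alive_below n \<omega>)\<^sup>2)"
  proof (rule integrable_const_bound[of _ "(real (card (sticks_below k R n)))\<^sup>2"])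
    show "AE \<omega> in M. norm ((alive_below n \<omega>)\<^sup>2) \<le> (real (card (sticks_below k R n)))\<^sup>2"
      using power_mono[OF bd, of _ 2] by simp
  qed simp
  have "prob {\<omega> \<in> space M. card (resulting_sticks k R A N \<omega>) < c * R}
    \<le> prob {\<omega> \<in> space M. \<mu> / 2 \<le> \<bar>alive_below n \<omega> - expectation (alive_below n)\<bar>}"
    using sub by (rule finite_measure_mono) measurable
  also have "\<dots> \<le> variance (alive_below n) / (\<mu> / 2)\<^sup>2"
    using \<mu> sq_int by (intro Chebyshev_inequality) auto
  also have "\<dots> \<le> real R * (real (num_words k n))\<^sup>2 / (\<mu> / 2)\<^sup>2"
    by (intro divide_right_mono alive_below_variance) simp
  also have "\<dots> = 4 * (real (num_words k n))\<^sup>2 / real R / (real n)\<^sup>2"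
    using R n by (simp add: \<mu>_def power2_eq_square field_simps)
  also have "\<dots> \<le> 4 * (real (num_words k n))\<^sup>2 / real R / 1"
    using n by (intro divide_left_mono) (auto intro: one_le_power)
  finally show ?thesis by simp
qed

end

section \<open>Convergence to Benford behaviour\<close>

lemma fraction_le_measurable:
  assumes B: "1 < B" and S: "finite S" and len: "\<And>v. v \<in> S \<Longrightarrow> (\<lambda>\<omega>. len \<omega> v) \<in> borel_measurable M"
  shows "(\<lambda>\<omega>. fraction_le B s (len \<omega>) S) \<in> borel_measurable M"
proof -
  have sig [measurable]: "(\<lambda>\<omega>. significand B (len \<omega> v)) \<in> borel_measurable M" if "v \<in> S" for v
    by (rule measurable_compose[OF len[OF that] borel_measurable_significand[OF B]])
  have "(\<lambda>\<omega>. fraction_le B s (len \<omega>) S) =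
      (\<lambda>\<omega>. (\<Sum>v\<in>S. if significand B (len \<omega> v) \<le> s then 1 else 0) / real (card S))"
    using S by (simp add: fraction_le_def sum.If_cases Int_def)
  also have "\<dots> \<in> borel_measurable M" by measurable
  finally show ?thesis .
qed

lemma fraction_le_cong:
  "(\<And>v. v \<in> S \<Longrightarrow> len v = len' v) \<Longrightarrow> fraction_le B s len S = fraction_le B s len' S"
  unfolding fraction_le_def by (metis (mono_tags, lifting) Collect_cong)

context good_fragmentation
begin

lemma benford_proportion_eq:
  "benford_proportion k L R X A N B s \<omega> =
    fraction_le B s (stick_length k L (\<lambda>v x. x v) (all_cuts \<omega>)) (resulting_sticks k R A N \<omega>)"
proof -
  have "benford_proportion k L R X A N B s \<omega> =
      fraction_le B s (stick_length k L X \<omega>) (resulting_sticks k R A N \<omega>)"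
    by (simp add: benford_proportion_def fraction_le_def)
  also have "\<dots> = fraction_le B s (stick_length k L (\<lambda>v x. x v) (all_cuts \<omega>)) (resulting_sticks k R A N \<omega>)"
    by (rule fraction_le_cong, rule stick_length_restrict[symmetric]) (simp add: resulting_sticks_def)
  finally show ?thesis .
qed

lemma fraction_le_cuts_measurable:
  assumes "1 < B" "S \<subseteq> sticks_below k R n"
  shows "(\<lambda>x. fraction_le B s (stick_length k L (\<lambda>v x. x v) x) S)
    \<in> borel_measurable (PiM (potential_sticks k R) (\<lambda>_. D))"
proof (rule fraction_le_measurable[OF assms(1)])
  show "finite S" using assms finite_sticks_below by (auto intro: finite_subset)
  fix v assume "v \<in> S"
  then have "v \<in> potential_sticks k R" using assms sticks_below_subset by blast
  then show "(\<lambda>x. stick_length k L (\<lambda>v x. x v) x v) \<in> borel_measurable (PiM (potential_sticks k R) (\<lambda>_. D))"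
    by (intro stick_length_measurable[OF k_ge_1 good, where R = R] measurable_component_singleton)
qed

lemma benford_proportion_integrable:
  assumes "1 < B"
  shows "integrable M (benford_proportion k L R X A N B s)"
proof -
  have "integrable M (\<lambda>\<omega>. fraction_le B s (stick_length k L (\<lambda>v x. x v) (all_cuts \<omega>)) (resulting_sticks k R A N \<omega>))"
    by (rule expectation_resulting_sticks(1)
        [where h = "\<lambda>S x. fraction_le B s (stick_length k L (\<lambda>v x. x v) x) S"])
      (auto intro!: fraction_le_cuts_measurable assms fraction_le_01)
  then show ?thesis unfolding benford_proportion_eq[symmetric, abs_def] .
qed

text \<open>On the event that fewer than \<open>c\<close> sticks result, the deviation is at most \<open>1\<close>; otherwise the set of
  resulting sticks is large enough for the bound for fixed sets.\<close>

lemma benford_proportion_deviation: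
  assumes B: "1 < B" and s: "1 \<le> s" "s < B" and e: "0 \<le> e"
    and large: "\<And>S. finite S \<Longrightarrow> S \<subseteq> potential_sticks k R \<Longrightarrow> c \<le> card S \<Longrightarrow>
      expectation (\<lambda>\<omega>. \<bar>fraction_le B s (stick_length k L X \<omega>) S - log B s\<bar>) \<le> e"
  shows "expectation (\<lambda>\<omega>. \<bar>benford_proportion k L R X A N B s \<omega> - log B s\<bar>)
    \<le> e + prob {\<omega> \<in> space M. card (resulting_sticks k R A N \<omega>) < c}"
proof -
  define h where "h S x = \<bar>fraction_le B s (stick_length k L (\<lambda>v x. x v) x) S - log B s\<bar>" for S x
  have s01: "0 \<le> log B s" "log B s \<le> 1" using B s by (auto simp: log_le_iff)
  have "expectation (\<lambda>\<omega>. h (resulting_sticks k R A N \<omega>) (all_cuts \<omega>))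
    \<le> e + prob {\<omega> \<in> space M. card (resulting_sticks k R A N \<omega>) < c}"
  proof (rule expectation_resulting_sticks_le[OF _ _ _ _ e])
    fix S assume S: "S \<subseteq> sticks_below k R (Suc N)"
    show "h S \<in> borel_measurable (PiM (potential_sticks k R) (\<lambda>_. D))"
      using fraction_le_cuts_measurable[OF B S] unfolding h_def by measurable
    assume "c \<le> card S"
    have SP: "finite S" "S \<subseteq> potential_sticks k R"
      using finite_subset[OF S finite_sticks_below] S sticks_below_subset[of k R "Suc N"] by auto
    have "h S (all_cuts \<omega>) = \<bar>fraction_le B s (stick_length k L X \<omega>) S - log B s\<bar>" for \<omega>
    proof -
      have "fraction_le B s (stick_length k L (\<lambda>v x. x v) (all_cuts \<omega>)) S =
          fraction_le B s (stick_length k L X \<omega>) S"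
        using SP by (intro fraction_le_cong stick_length_restrict) blast
      then show ?thesis by (simp only: h_def)
    qed
    then show "expectation (\<lambda>\<omega>. h S (all_cuts \<omega>)) \<le> e"
      using large[OF SP \<open>c \<le> card S\<close>] by simp
  next
    fix S :: "stick set" and x assume "finite S"
    then show "h S x \<le> 1"
      using fraction_le_01[of S B s "stick_length k L (\<lambda>v x. x v) x"] s01 by (auto simp: h_def abs_le_iff)
  qed (simp add: h_def)
  then show ?thesis unfolding h_def benford_proportion_eq .
qed

end

lemma benford_proportion_L1:
  fixes M :: "nat \<Rightarrow> 'a measure"
  assumes k: "2 \<le> k" and L: "0 < L" and good: "good_distribution (k - 1) D"
    and frag: "\<And>R. 1 \<le> R \<Longrightarrow> fragmentation (M R) k (1 / real k) D R (X R) (A R)"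
    and N: "\<And>R. 1 \<le> R \<Longrightarrow> ln (real R) \<le> real (N R)"
    and B: "1 < B" and s: "1 \<le> s" "s < B"
  shows "(\<lambda>R. integral\<^sup>L (M R) (\<lambda>\<omega>. \<bar>benford_proportion k L R (X R) (A R) (N R) B s \<omega> - log B s\<bar>))
    \<longlonglongrightarrow> 0"
proof (rule tendstoI)
  fix e :: real assume e: "0 < e"
  then have e3: "0 < e / 3" by simp
  have k1: "1 \<le> k" using k by simp
  obtain C0 :: nat where C0: "\<And>(M :: 'a measure) r R X A L S.
    good_fragmentation M k r D R X A \<Longrightarrow> 0 < L \<Longrightarrow> 1 \<le> R \<Longrightarrow> finite S \<Longrightarrow> S \<subseteq> potential_sticks k R \<Longrightarrow>
    S \<noteq> {} \<Longrightarrow> C0 * R \<le> card S \<Longrightarrow>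
    integral\<^sup>L M (\<lambda>\<omega>. \<bar>fraction_le B s (stick_length k L X \<omega>) S - log B s\<bar>) \<le> e / 3"
    using fixed_sticks_benford[OF k1 good B s e3, where ?'a = 'a] by metis
  \<comment> \<open>the successor makes \<open>c * R\<close> positive, so that a set of at least this size is not
      empty\<close>
  define c where "c = Suc C0"
  define n where "n = 2 * c"
  have "filterlim (\<lambda>R. ln (real R)) at_top sequentially"
    by (rule filterlim_compose[OF ln_at_top filterlim_real_sequentially])
  then have "\<forall>\<^sub>F R in sequentially. real n \<le> ln (real R)"
    by (auto simp: filterlim_at_top)
  moreover have "\<forall>\<^sub>F R in sequentially. 4 * (real (num_words k n))\<^sup>2 / (e / 3) \<le> real R"
    using filterlim_real_sequentially by (auto simp: filterlim_at_top)
  moreover have "\<forall>\<^sub>F R in sequentially. 1 \<le> R" by (rule eventually_ge_at_top)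
  ultimately show "\<forall>\<^sub>F R in sequentially.
    dist (integral\<^sup>L (M R) (\<lambda>\<omega>. \<bar>benford_proportion k L R (X R) (A R) (N R) B s \<omega> - log B s\<bar>)) 0 < e"
  proof eventually_elim
    case (elim R)
    interpret fragmentation "M R" k "1 / real k" D R "X R" "A R" by (rule frag[OF elim(3)])
    interpret good_fragmentation "M R" k "1 / real k" D R "X R" "A R"
      by unfold_locales (use k1 good in auto)
    have "expectation (\<lambda>\<omega>. \<bar>benford_proportion k L R (X R) (A R) (N R) B s \<omega> - log B s\<bar>)
      \<le> e / 3 + prob {\<omega> \<in> space (M R). card (resulting_sticks k R (A R) (N R) \<omega>) < c * R}"
    proof (rule benford_proportion_deviation[OF B s])
      fix S assume S: "finite S" "S \<subseteq> potential_sticks k R" "c * R \<le> card S"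
      have "S \<noteq> {}" "C0 * R \<le> card S" using S elim(3) by (auto simp: c_def)
      then show "expectation (\<lambda>\<omega>. \<bar>fraction_le B s (stick_length k L (X R) \<omega>) S - log B s\<bar>) \<le> e / 3"
        using S by (intro C0[OF good_fragmentation_axioms L elim(3)])
    qed (use e in simp)
    also have "prob {\<omega> \<in> space (M R). card (resulting_sticks k R (A R) (N R) \<omega>) < c * R}
        \<le> 4 * (real (num_words k n))\<^sup>2 / real R"
    proof (rule few_resulting_sticks_prob[OF k _ elim(3)])
      show "1 / real k * real k = 1" using k by simp
      show "n \<le> N R" using elim(1) N[OF elim(3)] by linarith
      show "1 \<le> n" "2 * c \<le> n" by (auto simp: n_def c_def)
    qed
    also have "4 * (real (num_words k n))\<^sup>2 / real R \<le> e / 3"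
      using elim(2,3) e by (simp add: field_simps)
    finally have "expectation (\<lambda>\<omega>. \<bar>benford_proportion k L R (X R) (A R) (N R) B s \<omega> - log B s\<bar>) < e"
      using e by simp
    moreover have "0 \<le> expectation (\<lambda>\<omega>. \<bar>benford_proportion k L R (X R) (A R) (N R) B s \<omega> - log B s\<bar>)"
      by (rule Bochner_Integration.integral_nonneg) simp
    ultimately show ?case by simp
  qed
qed

text \<open>The variance is at most the mean square distance to any constant, and \<open>|P - \<alpha>| \<le> 1\<close>.\<close>

lemma (in prob_space) moments_near_constant:
  fixes P :: "'a \<Rightarrow> real"
  assumes int: "integrable M P" and P: "\<And>\<omega>. 0 \<le> P \<omega>" "\<And>\<omega>. P \<omega> \<le> 1" and \<alpha>: "0 \<le> \<alpha>" "\<alpha> \<le> 1"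
  shows "\<bar>expectation P - \<alpha>\<bar> \<le> expectation (\<lambda>\<omega>. \<bar>P \<omega> - \<alpha>\<bar>)"
    and "variance P \<le> expectation (\<lambda>\<omega>. \<bar>P \<omega> - \<alpha>\<bar>)"
proof -
  have "expectation P - \<alpha> = expectation (\<lambda>\<omega>. P \<omega> - \<alpha>)"
    using int by (simp add: prob_space)
  then show "\<bar>expectation P - \<alpha>\<bar> \<le> expectation (\<lambda>\<omega>. \<bar>P \<omega> - \<alpha>\<bar>)"
    using integral_abs_bound[of M "\<lambda>\<omega>. P \<omega> - \<alpha>"] by simp
  have [measurable]: "P \<in> borel_measurable M" using int by (rule borel_measurable_integrable)
  have sq: "integrable M (\<lambda>\<omega>. (P \<omega>)\<^sup>2)"
  proof (rule integrable_const_bound[of _ 1])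
    show "AE \<omega> in M. norm ((P \<omega>)\<^sup>2) \<le> 1"
      using P by (auto simp: power_le_one)
  qed simp
  have "expectation (\<lambda>\<omega>. (P \<omega> - \<alpha>)\<^sup>2) = expectation (\<lambda>\<omega>. (P \<omega>)\<^sup>2) - 2 * \<alpha> * expectation P + \<alpha>\<^sup>2"
    using sq int by (simp add: power2_diff prob_space algebra_simps)
  also have "\<dots> = variance P + (expectation P - \<alpha>)\<^sup>2"
    using variance_eq[OF int sq] by (simp add: power2_diff)
  finally have "variance P \<le> expectation (\<lambda>\<omega>. (P \<omega> - \<alpha>)\<^sup>2)" by simp
  also have "\<dots> \<le> expectation (\<lambda>\<omega>. \<bar>P \<omega> - \<alpha>\<bar>)"
  proof (rule integral_mono_AE')
    have "(P \<omega> - \<alpha>)\<^sup>2 \<le> \<bar>P \<omega> - \<alpha>\<bar>" for \<omega>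
    proof -
      have "\<bar>P \<omega> - \<alpha>\<bar> \<le> 1" using P[of \<omega>] \<alpha> by (auto simp: abs_le_iff)
      then have "\<bar>P \<omega> - \<alpha>\<bar> * \<bar>P \<omega> - \<alpha>\<bar> \<le> \<bar>P \<omega> - \<alpha>\<bar> * 1" by (intro mult_left_mono) auto
      then show ?thesis by (simp add: power2_eq_square abs_mult[symmetric])
    qed
    then show "AE \<omega> in M. (P \<omega> - \<alpha>)\<^sup>2 \<le> \<bar>P \<omega> - \<alpha>\<bar>" by simp
  qed (use int in auto)
  finally show "variance P \<le> expectation (\<lambda>\<omega>. \<bar>P \<omega> - \<alpha>\<bar>)" .
qed

theorem theorem1p10:
  fixes k :: nat and L :: real and D :: "(nat \<Rightarrow> real) measure"
    and M :: "nat \<Rightarrow> 'a measure"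
    and X :: "nat \<Rightarrow> stick \<Rightarrow> 'a \<Rightarrow> nat \<Rightarrow> real"
    and A :: "nat \<Rightarrow> stick \<Rightarrow> 'a \<Rightarrow> nat \<Rightarrow> bool"
    and N :: "nat \<Rightarrow> nat" and B s :: real
  assumes "2 \<le> k" and "0 < L"
    and "good_distribution (k - 1) D"
    and "\<And>R. 1 \<le> R \<Longrightarrow> fragmentation (M R) k (1 / real k) D R (X R) (A R)"
    and "\<And>R. 1 \<le> R \<Longrightarrow> 1 \<le> N R \<and> ln (real R) \<le> real (N R)"
    and "1 < B" and "s \<in> {1..<B}"
  shows "(\<lambda>R. prob_space.expectation (M R)
            (benford_proportion k L R (X R) (A R) (N R) B s)) \<longlonglongrightarrow> log B s \<and>
         (\<lambda>R. prob_space.variance (M R)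
            (benford_proportion k L R (X R) (A R) (N R) B s)) \<longlonglongrightarrow> 0"
proof -
  let ?P = "\<lambda>R. benford_proportion k L R (X R) (A R) (N R) B s"
  let ?dev = "\<lambda>R. integral\<^sup>L (M R) (\<lambda>\<omega>. \<bar>?P R \<omega> - log B s\<bar>)"
  have s: "1 \<le> s" "s < B" using assms(7) by auto
  have s01: "0 \<le> log B s" "log B s \<le> 1" using assms(6) s by (auto simp: log_le_iff)
  have dev: "?dev \<longlonglongrightarrow> 0"
    using assms(5) by (intro benford_proportion_L1[OF assms(1-4) _ assms(6) s]) auto
  have bounds: "\<bar>prob_space.expectation (M R) (?P R) - log B s\<bar> \<le> ?dev R"
    "prob_space.variance (M R) (?P R) \<le> ?dev R" "0 \<le> prob_space.variance (M R) (?P R)"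
    if R: "1 \<le> R" for R
  proof -
    interpret fragmentation "M R" k "1 / real k" D R "X R" "A R" by (rule assms(4)[OF R])
    interpret good_fragmentation "M R" k "1 / real k" D R "X R" "A R"
      by unfold_locales (use assms(1,3) in auto)
    have "0 \<le> ?P R \<omega>" "?P R \<omega> \<le> 1" for \<omega>
      unfolding benford_proportion_eq using finite_resulting_sticks by (auto intro!: fraction_le_01)
    from moments_near_constant[OF benford_proportion_integrable[OF assms(6)] this s01]
    show "\<bar>prob_space.expectation (M R) (?P R) - log B s\<bar> \<le> ?dev R"
      "prob_space.variance (M R) (?P R) \<le> ?dev R" by auto
    show "0 \<le> prob_space.variance (M R) (?P R)" by (rule variance_positive)
  qed
  have ev: "\<forall>\<^sub>F R in sequentially. 1 \<le> (R::nat)" by (rule eventually_ge_at_top)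
  show ?thesis
  proof
    have "(\<lambda>R. prob_space.expectation (M R) (?P R) - log B s) \<longlonglongrightarrow> 0"
      by (rule Lim_null_comparison[OF _ dev], rule eventually_mono[OF ev])
        (simp only: real_norm_def bounds(1))
    then show "(\<lambda>R. prob_space.expectation (M R) (?P R)) \<longlonglongrightarrow> log B s"
      by (rule Lim_null[THEN iffD2])
    show "(\<lambda>R. prob_space.variance (M R) (?P R)) \<longlonglongrightarrow> 0"
      by (rule tendsto_sandwich[OF _ _ tendsto_const dev]; rule eventually_mono[OF ev])
        (simp_all only: bounds(2,3))
  qed
qed

end
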